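(* There exists a graph that admits a planar storyplan but does not admit a planar geometric storyplan.
   Context: A storyplan of a graph $G$ on time steps $[\ell]=\{1,\dots,\ell\}$, $\ell\in\mathbb{N}$, is a pair $(A,\mathcal{D})$ where: $A$ assigns to each vertex $v$ a nonempty interval $A(v)=[s_v,e_v]\subseteq[\ell]$ of consecutive integers (the visible interval; $v$ is visible at each $t\in A(v)$); for every edge $uv$ of $G$ we have $A(u)\cap A(v)\neq\emptyset$; and $\mathcal{D}$ assigns to each vertex a point of the plane and to each edge a curve between the points of its endpoints (one fixed drawing of each vertex and edge, used in all time steps). For $t\in[\ell]$, the frame at $t$ is the drawing under $\mathcal{D}$ of the induced subgraph $G[\{v : t\in A(v)\}]$, and each frame must be a simple drawing. Several vertices may appear in the same time step. A storyplan is planar if every frame is a planar drawing (no crossings), and planar geometric if every frame is a planar drawing in which every edge is a straight-line segment. *)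

theory Defs
  imports "HOL-Analysis.Analysis"
begin

type_synonym point = "real \<times> real"

definition simple_graph :: "nat set \<Rightarrow> nat set set \<Rightarrow> bool" where
  "simple_graph V E \<longleftrightarrow> finite V \<and>
     (\<forall>e\<in>E. \<exists>u v. u \<in> V \<and> v \<in> V \<and> u \<noteq> v \<and> e = {u, v})"

definition curve_between :: "(nat \<Rightarrow> point) \<Rightarrow> nat set \<Rightarrow> (real \<Rightarrow> point) \<Rightarrow> bool" where
  "curve_between p e g \<longleftrightarrow> path g \<and>
     (\<exists>u v. e = {u, v} \<and> pathstart g = p u \<and> pathfinish g = p v)"

definition storyplan ::
  "nat set \<Rightarrow> nat set set \<Rightarrow> nat \<Rightarrow> (nat \<Rightarrow> nat set) \<Rightarrow> (nat \<Rightarrow> point)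
     \<Rightarrow> (nat set \<Rightarrow> real \<Rightarrow> point) \<Rightarrow> bool" where
  "storyplan V E l A p gam \<longleftrightarrow> l \<ge> 1 \<and>
     (\<forall>v\<in>V. \<exists>s e. 1 \<le> s \<and> s \<le> e \<and> e \<le> l \<and> A v = {s..e}) \<and>
     (\<forall>uv\<in>E. \<forall>u v. uv = {u, v} \<longrightarrow> A u \<inter> A v \<noteq> {}) \<and>
     (\<forall>e\<in>E. curve_between p e (gam e))"

definition frame_vertices :: "nat set \<Rightarrow> (nat \<Rightarrow> nat set) \<Rightarrow> nat \<Rightarrow> nat set" where
  "frame_vertices V A t = {v \<in> V. t \<in> A v}"

definition frame_edges :: "nat set \<Rightarrow> nat set set \<Rightarrow> (nat \<Rightarrow> nat set) \<Rightarrow> nat \<Rightarrow> nat set set" where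
  "frame_edges V E A t = {e \<in> E. e \<subseteq> frame_vertices V A t}"

definition is_drawing ::
  "nat set \<Rightarrow> nat set set \<Rightarrow> (nat \<Rightarrow> point) \<Rightarrow> (nat set \<Rightarrow> real \<Rightarrow> point) \<Rightarrow> bool" where
  "is_drawing W F p gam \<longleftrightarrow> inj_on p W \<and>
     (\<forall>e\<in>F. arc (gam e) \<and> curve_between p e (gam e) \<and>
        (\<forall>w\<in>W. p w \<in> path_image (gam e) \<longrightarrow> w \<in> e))"

text \<open>Simple drawing (necessary conditions): adjacent edges meet only at their common
  endpoint, and two edges share at most one point.\<close>
definition simple_drawing ::
  "nat set \<Rightarrow> nat set set \<Rightarrow> (nat \<Rightarrow> point) \<Rightarrow> (nat set \<Rightarrow> real \<Rightarrow> point) \<Rightarrow> bool" where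
  "simple_drawing W F p gam \<longleftrightarrow> is_drawing W F p gam \<and>
     (\<forall>e\<in>F. \<forall>f\<in>F. e \<noteq> f \<longrightarrow>
        finite (path_image (gam e) \<inter> path_image (gam f)) \<and>
        card (path_image (gam e) \<inter> path_image (gam f)) \<le> 1 \<and>
        (e \<inter> f \<noteq> {} \<longrightarrow> path_image (gam e) \<inter> path_image (gam f) \<subseteq> p ` (e \<inter> f)))"

definition planar_drawing ::
  "nat set \<Rightarrow> nat set set \<Rightarrow> (nat \<Rightarrow> point) \<Rightarrow> (nat set \<Rightarrow> real \<Rightarrow> point) \<Rightarrow> bool" where
  "planar_drawing W F p gam \<longleftrightarrow> simple_drawing W F p gam \<and>
     (\<forall>e\<in>F. \<forall>f\<in>F. e \<noteq> f \<longrightarrow>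
        path_image (gam e) \<inter> path_image (gam f) \<subseteq> p ` (e \<inter> f))"

definition planar_storyplan ::
  "nat set \<Rightarrow> nat set set \<Rightarrow> nat \<Rightarrow> (nat \<Rightarrow> nat set) \<Rightarrow> (nat \<Rightarrow> point)
     \<Rightarrow> (nat set \<Rightarrow> real \<Rightarrow> point) \<Rightarrow> bool" where
  "planar_storyplan V E l A p gam \<longleftrightarrow> storyplan V E l A p gam \<and>
     (\<forall>t\<in>{1..l}. planar_drawing (frame_vertices V A t) (frame_edges V E A t) p gam)"

definition planar_geometric_storyplan ::
  "nat set \<Rightarrow> nat set set \<Rightarrow> nat \<Rightarrow> (nat \<Rightarrow> nat set) \<Rightarrow> (nat \<Rightarrow> point)
     \<Rightarrow> (nat set \<Rightarrow> real \<Rightarrow> point) \<Rightarrow> bool" where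
  "planar_geometric_storyplan V E l A p gam \<longleftrightarrow> planar_storyplan V E l A p gam \<and>
     (\<forall>t\<in>{1..l}. \<forall>e\<in>frame_edges V E A t.
        \<exists>u v. e = {u, v} \<and> path_image (gam e) = closed_segment (p u) (p v))"

definition admits_planar_storyplan :: "nat set \<Rightarrow> nat set set \<Rightarrow> bool" where
  "admits_planar_storyplan V E \<longleftrightarrow> (\<exists>l A p gam. planar_storyplan V E l A p gam)"

definition admits_planar_geometric_storyplan :: "nat set \<Rightarrow> nat set set \<Rightarrow> bool" where
  "admits_planar_geometric_storyplan V E \<longleftrightarrow>
     (\<exists>l A p gam. planar_geometric_storyplan V E l A p gam)"

end

theory Submission
  imports Defs
begin

text \<open>
  Let a, d, b span a triangle of a straight-line drawing, let x be a vertex inside it joined to its corners,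
  and let y and z be vertices in the triangles a x d and a x b. Then the ray from a through x separates y from z,
  so the direction of y as seen from a is closer to d than that of z. Two such vertices x, shown at
  different times and asking for opposite orders of the same y and z, contradict each other if edges are
  segments, but not if the edge a x may bend.

  The rest of the graph forces this configuration. A vertex d joined to a, b, c and its copies cannot
  be shown together in large numbers, so some copy of d lives only while a, b, c are all shown; by the
  same argument some copy of x lives only while a, b, c, d are all shown, and then everything in a
  triangle with x is shown together with a, b, c, d at some time. To be sure that x lies inside
  the triangle, not outside, x is attached to two faces of the drawn K4, one of which
  has its inner vertex as a corner.
\<close>

section \<open>Straight-line drawings\<close>

text \<open>Substituting the second convex combination into the first leaves (1 - w w') x as a
  nonnegative combination of a and b. Either w w' < 1 and division puts x on the side ab, or w = w'
  = 1 and x = c.\<close>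

lemma mutual_hull3:
  fixes a b c x :: "'a::real_vector"
  assumes "x \<in> convex hull {a, b, c}" "c \<in> convex hull {a, b, x}"
  shows "x = c \<or> x \<in> closed_segment a b"
proof -
  obtain u v w where x: "x = u *\<^sub>R a + v *\<^sub>R b + w *\<^sub>R c" "0 \<le> u" "0 \<le> v" "0 \<le> w" "u + v + w = 1"
    using assms(1) unfolding convex_hull_3 by blast
  obtain u' v' w' where c: "c = u' *\<^sub>R a + v' *\<^sub>R b + w' *\<^sub>R x" "0 \<le> u'" "0 \<le> v'" "0 \<le> w'" "u' + v' + w' = 1"
    using assms(2) unfolding convex_hull_3 by blast
  show ?thesis
  proof (cases "w = 1 \<and> w' = 1")
    case True
    then have *: "u = 0" "v = 0" "w = 1" using x by linarith+
    show ?thesis using x(1) unfolding * by simp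
  next
    case False
    define d where "d = 1 - w * w'"
    have "w * w' < 1"
    proof (cases "w = 1")
      case True
      then have "w' < 1" using False c by auto
      then show ?thesis using True by simp
    next
      case False
      then have "w < 1" using x by linarith
      then show ?thesis using mult_left_mono[of w' 1 w] x c by linarith
    qed
    then have "d > 0" by (simp add: d_def)
    have "d *\<^sub>R x = (u + w * u') *\<^sub>R a + (v + w * v') *\<^sub>R b"
    proof -
      have "x = u *\<^sub>R a + v *\<^sub>R b + w *\<^sub>R (u' *\<^sub>R a + v' *\<^sub>R b + w' *\<^sub>R x)"
        using x(1) c(1) by simp
      then show ?thesis by (simp add: d_def algebra_simps)
    qed
    then have "x = inverse d *\<^sub>R ((u + w * u') *\<^sub>R a + (v + w * v') *\<^sub>R b)"
      using \<open>d > 0\<close> by (metis less_irrefl scaleR_one scaleR_scaleR left_inverse)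
    then have "x = ((u + w * u') / d) *\<^sub>R a + ((v + w * v') / d) *\<^sub>R b"
      by (simp add: scaleR_add_right divide_inverse mult.commute)
    moreover have "(u + w * u') / d + (v + w * v') / d = 1"
    proof -
      have "u + w * u' + (v + w * v') = d"
        using x(5) c(5) unfolding d_def by algebra
      then show ?thesis using \<open>d > 0\<close> by (simp flip: add_divide_distrib)
    qed
    moreover have "0 \<le> (v + w * v') / d" "0 \<le> (u + w * u') / d"
      using x c \<open>d > 0\<close> by simp_all
    ultimately have "x = (1 - (v + w * v') / d) *\<^sub>R a + ((v + w * v') / d) *\<^sub>R b
        \<and> 0 \<le> (v + w * v') / d \<and> (v + w * v') / d \<le> 1"
      by (smt (verit))
    then show ?thesis unfolding in_segment by blast
  qed
qed

text \<open>Cross product of \<open>b - a\<close> and \<open>c - a\<close>, twice the signed area of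
  the triangle: its sign is the orientation, and it is zero for collinear points.\<close>

definition turn :: "point \<Rightarrow> point \<Rightarrow> point \<Rightarrow> real" where
  "turn a b c = (fst b - fst a) * (snd c - snd a) - (snd b - snd a) * (fst c - fst a)"

lemma turn_swap: "turn a c b = - turn a b c"
  by (simp add: turn_def)

lemma in_triangle_off_side:
  fixes a x c y :: "'a::real_vector"
  assumes "y \<in> convex hull {a, x, c}" "y \<notin> closed_segment a x"
  obtains s t where "y = a + s *\<^sub>R (x - a) + t *\<^sub>R (c - a)" "0 \<le> s" "0 < t"
proof -
  obtain s t where y: "y = a + s *\<^sub>R (x - a) + t *\<^sub>R (c - a)" "0 \<le> s" "0 \<le> t" "s + t \<le> 1"
    using assms(1) unfolding convex_hull_3_alt by blast
  have "t \<noteq> 0"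
  proof
    assume "t = 0"
    then have "y = (1 - s) *\<^sub>R a + s *\<^sub>R x" "s \<le> 1" using y by (simp_all add: algebra_simps)
    then show False using assms(2) y(2) unfolding in_segment by blast
  qed
  then show thesis using that y by auto
qed

text \<open>By bilinearity of the cross product, \<open>turn a z y\<close> is
  \<open>turn a b c\<close> times a sum whose last term m m' is positive and whose other terms are
  nonnegative. So z and y appear around a in the same rotational order as b and c.\<close>

lemma turn_across_ray:
  assumes "x \<in> convex hull {a, b, c}" "turn a b c \<noteq> 0"
    and "y \<in> convex hull {a, x, c}" "y \<notin> closed_segment a x"
    and "z \<in> convex hull {a, x, b}" "z \<notin> closed_segment a x"
  shows "turn a b c * turn a z y > 0"
proof -
  obtain s t where x: "x = a + s *\<^sub>R (b - a) + t *\<^sub>R (c - a)" "0 \<le> s" "0 \<le> t"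
    using assms(1) unfolding convex_hull_3_alt by blast
  obtain l m where y: "y = a + l *\<^sub>R (x - a) + m *\<^sub>R (c - a)" "0 \<le> l" "0 < m"
    using in_triangle_off_side assms(3,4) by blast
  obtain l' m' where z: "z = a + l' *\<^sub>R (x - a) + m' *\<^sub>R (b - a)" "0 \<le> l'" "0 < m'"
    using in_triangle_off_side assms(5,6) by blast
  have "turn a z y = turn a b c * (l' * m * s + m' * l * t + m * m')"
    unfolding turn_def y(1) z(1) x(1) by (simp add: algebra_simps)
  moreover have "l' * m * s + m' * l * t + m * m' > 0"
    using x y z by (simp add: add_nonneg_pos)
  ultimately have "turn a b c * turn a z y = (turn a b c)\<^sup>2 * (l' * m * s + m' * l * t + m * m')"
    by (simp add: power2_eq_square)
  then show ?thesis
    using \<open>l' * m * s + m' * l * t + m * m' > 0\<close> assms(2) by simp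
qed

lemma between_if_turn_0:
  assumes "turn a b c = 0"
  shows "a \<in> closed_segment b c \<or> b \<in> closed_segment c a \<or> c \<in> closed_segment a b"
proof -
  have "collinear {c, a, b}"
  proof (cases "c = a")
    case False
    define r where "r = (if fst c = fst a then (snd b - snd a) / (snd c - snd a)
      else (fst b - fst a) / (fst c - fst a))"
    have "b - a = r *\<^sub>R (c - a)"
      using False assms unfolding r_def turn_def
      by (auto simp: prod_eq_iff field_simps)
    then show ?thesis by (auto simp: collinear_3 collinear_lemma)
  qed simp
  then show ?thesis
    by (auto simp: collinear_between_cases between_mem_segment closed_segment_commute)
qed

text \<open>What the argument uses of one frame, without curves or time. Edges with a common end
  cannot overlap either: an end of one would lie on the other, against
  \<open>off_edge\<close>.\<close>

locale straight_drawing =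
  fixes W :: "'a set" and adj :: "'a \<Rightarrow> 'a \<Rightarrow> bool" and q :: "'a \<Rightarrow> point"
  assumes adj_sym: "adj u v \<Longrightarrow> adj v u"
    and adj_irrefl: "\<not> adj u u"
    and inj_q: "inj_on q W"
    and off_edge: "\<lbrakk>u \<in> W; v \<in> W; w \<in> W; adj u v; w \<noteq> u; w \<noteq> v\<rbrakk>
      \<Longrightarrow> q w \<notin> closed_segment (q u) (q v)"
    and no_crossing: "\<lbrakk>u \<in> W; v \<in> W; u' \<in> W; v' \<in> W; adj u v; adj u' v'; {u, v} \<inter> {u', v'} = {}\<rbrakk>
      \<Longrightarrow> closed_segment (q u) (q v) \<inter> closed_segment (q u') (q v') = {}"
begin

section \<open>Triangles and K4s in a straight-line drawing\<close>

abbreviation hull3 :: "'a \<Rightarrow> 'a \<Rightarrow> 'a \<Rightarrow> point set" where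
  "hull3 a b c \<equiv> convex hull {q a, q b, q c}"

definition clique3 :: "'a \<Rightarrow> 'a \<Rightarrow> 'a \<Rightarrow> bool" where
  "clique3 a b c \<longleftrightarrow> a \<in> W \<and> b \<in> W \<and> c \<in> W \<and> adj a b \<and> adj b c \<and> adj a c"

definition clique4 :: "'a \<Rightarrow> 'a \<Rightarrow> 'a \<Rightarrow> 'a \<Rightarrow> bool" where
  "clique4 a b c x \<longleftrightarrow> clique3 a b c \<and> x \<in> W \<and> adj x a \<and> adj x b \<and> adj x c"

lemma clique4_rotate: "clique4 a b c x \<Longrightarrow> clique4 b c a x"
  unfolding clique4_def clique3_def using adj_sym by simp

lemma clique4_permute:
  assumes "clique4 a b c x"
  shows "clique4 a b x c" "clique4 a c b x" "clique4 a c x b" "clique4 a x c b" "clique4 a x b c"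
    "clique4 b x c a"
  using assms unfolding clique4_def clique3_def using adj_sym by simp_all

lemma hull3_rotate: "hull3 a b c = hull3 b c a"
  by (simp add: insert_commute)

text \<open>A segment leaving the hull would meet its frontier, which consists of three edges.\<close>
lemma stays_inside:
  assumes "clique3 a b c" "u \<in> W" "v \<in> W" "adj u v" "u \<notin> {a, b, c}" "v \<notin> {a, b, c}"
    and "q u \<in> hull3 a b c"
  shows "q v \<in> hull3 a b c"
proof (rule ccontr)
  assume "q v \<notin> hull3 a b c"
  then have "closed_segment (q u) (q v) \<inter> frontier (hull3 a b c) \<noteq> {}"
    using assms(7) by (intro connected_Int_frontier) auto
  moreover have "frontier (hull3 a b c)
      = closed_segment (q a) (q b) \<union> closed_segment (q b) (q c) \<union> closed_segment (q c) (q a)"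
    by (rule frontier_of_triangle) simp
  moreover have "closed_segment (q u) (q v) \<inter> closed_segment (q a) (q b) = {}"
    "closed_segment (q u) (q v) \<inter> closed_segment (q b) (q c) = {}"
    "closed_segment (q u) (q v) \<inter> closed_segment (q c) (q a) = {}"
    by (rule no_crossing; use assms(1-6) adj_sym in \<open>auto simp: clique3_def\<close>)+
  ultimately show False by blast
qed

lemma hull3_split:
  assumes "q x \<in> hull3 a b c" "q w \<in> hull3 a b c"
  shows "q w \<in> hull3 x b c \<or> q w \<in> hull3 a x c \<or> q w \<in> hull3 a b x"
proof -
  obtain b' where "b' \<in> {q a, q b, q c}" "q w \<in> convex hull (insert (q x) ({q a, q b, q c} - {b'}))"
    using in_convex_hull_exchange[OF assms] by blast
  \<comment> \<open>Only inclusions: if corners coincide, the set difference removes more than one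
    of them.\<close>
  moreover have "convex hull (insert (q x) ({q a, q b, q c} - {q a})) \<subseteq> hull3 x b c"
    "convex hull (insert (q x) ({q a, q b, q c} - {q b})) \<subseteq> hull3 a x c"
    "convex hull (insert (q x) ({q a, q b, q c} - {q c})) \<subseteq> hull3 a b x"
    by (intro hull_mono; blast)+
  ultimately show ?thesis by blast
qed

text \<open>If w were in the triangle abx, its neighbour c would be there as well by
  \<open>stays_inside\<close>. As x is in abc, \<open>mutual_hull3\<close> then makes x coincide
  with c or lie on the edge ab.\<close>

lemma separated_by_triangle:
  assumes "clique4 a b c x" "q x \<in> hull3 a b c" "w \<in> W" "w \<notin> {a, b, c, x}" "adj w c"
  shows "q w \<notin> hull3 a b x"
proof
  assume "q w \<in> hull3 a b x"
  have cl: "clique3 a b x" "c \<in> W" "x \<in> W" "adj a b" "a \<in> W" "b \<in> W" "c \<notin> {a, b, x}" "x \<notin> {a, b, c}"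
    using assms(1) adj_irrefl adj_sym unfolding clique4_def clique3_def by auto
  have "q c \<in> hull3 a b x"
    using stays_inside[of a b x w c] cl assms \<open>q w \<in> hull3 a b x\<close> by auto
  then have "q x = q c \<or> q x \<in> closed_segment (q a) (q b)"
    using mutual_hull3 assms(2) by blast
  then show False
    using cl inj_q off_edge[of a b x] by (auto dest: inj_onD)
qed

text \<open>The edge to x keeps w inside abc; of the three faces around x, the edge to c rules out
  abx and the edge to a rules out bcx.\<close>

lemma neighbour_in_face:
  assumes "clique4 a b c x" "q x \<in> hull3 a b c" "w \<in> W" "w \<noteq> b" "adj w a" "adj w c" "adj w x"
  shows "q w \<in> hull3 a x c"
proof -
  have cl: "clique3 a b c" "x \<in> W" "x \<notin> {a, b, c}" and w: "w \<notin> {a, b, c, x}"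
    using assms adj_irrefl unfolding clique4_def by auto
  have "q w \<in> hull3 a b c"
    using stays_inside[of a b c x w] cl w assms adj_sym by blast
  moreover have "q w \<notin> hull3 a b x"
    using separated_by_triangle[of a b c x w] assms w by auto
  moreover have "q w \<notin> hull3 b c x"
    using separated_by_triangle[of b c a x w] assms w hull3_rotate[of a b c] by (auto dest: clique4_rotate)
  ultimately show ?thesis
    using hull3_split[OF assms(2)] hull3_rotate[of x b c] by blast
qed

text \<open>Each of the three faces around x misses one corner of the triangle. As w is adjacent to
  that corner, \<open>separated_by_triangle\<close> excludes the face.\<close>

lemma inside_unique:
  assumes "clique4 a b c x" "q x \<in> hull3 a b c" "clique4 a b c w" "q w \<in> hull3 a b c"
  shows "w = x"
proof (rule ccontr)
  assume "w \<noteq> x"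
  then have w: "w \<in> W" "w \<notin> {a, b, c, x}" "adj w a" "adj w b" "adj w c"
    using assms(3) adj_irrefl unfolding clique4_def by auto
  have 1: "q w \<notin> hull3 a b x"
    using separated_by_triangle[of a b c x w] assms w by auto
  have 2: "q w \<notin> hull3 b c x"
    using separated_by_triangle[of b c a x w] assms w hull3_rotate[of a b c]
    by (auto dest: clique4_rotate)
  have 3: "q w \<notin> hull3 c a x"
    using separated_by_triangle[of c a b x w] assms w hull3_rotate[of a b c] hull3_rotate[of b c a]
    by (auto dest: clique4_rotate)
  show False
    using hull3_split[OF assms(2,4)] 1 2 3 by (auto simp: insert_commute)
qed

text \<open>Radon's theorem splits four points of the plane into two sets whose hulls meet. A split
  into pairs would be a crossing of two disjoint edges of the K4, so one point lies in the triangle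
  of the other three.\<close>

lemma clique4_has_inner_vertex:
  assumes "clique4 a b c x"
  shows "q x \<in> hull3 a b c \<or> q a \<in> hull3 b c x \<or> q b \<in> hull3 a c x \<or> q c \<in> hull3 a b x"
proof -
  have W: "a \<in> W" "b \<in> W" "c \<in> W" "x \<in> W" and d: "distinct [a, b, c, x]"
    and adj: "adj a b" "adj b c" "adj a c" "adj a x" "adj b x" "adj c x"
    using assms adj_irrefl adj_sym unfolding clique4_def clique3_def by auto
  then have d': "distinct [q a, q b, q c, q x]"
    using inj_q by (auto dest: inj_onD)
  let ?S = "{q a, q b, q c, q x}"
  have "affine_dependent ?S"
    using d' by (intro affine_dependent_biggerset) auto
  then obtain M P where MP: "M \<inter> P = {}" "M \<union> P = ?S" "convex hull M \<inter> convex hull P \<noteq> {}"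
    using Radon_partition[of ?S] by auto
  have "closed_segment (q a) (q b) \<inter> closed_segment (q c) (q x) = {}"
    "closed_segment (q a) (q c) \<inter> closed_segment (q b) (q x) = {}"
    "closed_segment (q a) (q x) \<inter> closed_segment (q b) (q c) = {}"
    by (rule no_crossing; use d W adj in simp)+
  then have seg: "convex hull {q a, q b} \<inter> convex hull {q c, q x} = {}"
    "convex hull {q a, q c} \<inter> convex hull {q b, q x} = {}"
    "convex hull {q a, q x} \<inter> convex hull {q b, q c} = {}"
    by (simp_all flip: segment_convex_hull)
  \<comment> \<open>All \<open>M\<close> are enumerated: the empty and the full set have hulls
    disjoint from that of the complement, pairs contradict \<open>seg\<close>, and the rest are the
    four claims.\<close>
  have "P = ?S - M" using MP by blast
  moreover have "M \<in> Pow ?S" using MP by blast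
  moreover have "q a \<noteq> q b" "q b \<noteq> q a" "q a \<noteq> q c" "q c \<noteq> q a" "q a \<noteq> q x" "q x \<noteq> q a"
    "q b \<noteq> q c" "q c \<noteq> q b" "q b \<noteq> q x" "q x \<noteq> q b" "q c \<noteq> q x" "q x \<noteq> q c"
    using d' by auto
  ultimately show ?thesis
    using MP(3) seg
    by (simp add: Pow_insert Pow_empty)
      (elim disjE; simp add: insert_Diff_if; simp add: insert_commute Int_commute)
qed

lemma clique3_turn:
  assumes "clique3 a b c"
  shows "turn (q a) (q b) (q c) \<noteq> 0"
  using assms between_if_turn_0 off_edge adj_sym adj_irrefl unfolding clique3_def by metis


text \<open>As z is outside, the inner vertex of the K4 is a corner, say a, in the triangle bcz. The
  neighbour w of a stays in this triangle, and its adjacency to b and c leaves only the face abc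
  around a, where w is not.\<close>

lemma outside_unique:
  assumes z: "clique4 a b c z" "q z \<notin> hull3 a b c" and w: "clique4 a b c w" "q w \<notin> hull3 a b c"
  shows "w = z"
proof (rule ccontr)
  assume "w \<noteq> z"
  have *: False if "clique4 a b c z" "clique4 a b c w" "q w \<notin> hull3 a b c" "q a \<in> hull3 b c z" for a b c
  proof -
    have cl: "clique3 b c z" "clique4 b c z a" "w \<in> W" "a \<in> W" "a \<notin> {b, c, z}" "w \<notin> {a, b, c, z}"
      "adj w a" "adj w b" "adj w c"
      using that(1,2) \<open>w \<noteq> z\<close> adj_irrefl adj_sym unfolding clique4_def clique3_def by auto
    have "q w \<in> hull3 b c z"
      using stays_inside[of b c z a w] cl that(4) adj_sym by auto
    moreover have "q w \<notin> hull3 z b a"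
      using separated_by_triangle[of z b c a w] cl that(4) hull3_rotate[of z b c]
      by (auto dest: clique4_rotate)
    moreover have "q w \<notin> hull3 c z a"
      using separated_by_triangle[of c z b a w] cl that(4) hull3_rotate[of b c z]
      by (auto dest: clique4_rotate)
    ultimately show False
      using hull3_split[OF that(4)] that(3) by (auto simp: insert_commute)
  qed
  consider "q a \<in> hull3 b c z" | "q b \<in> hull3 c a z" | "q c \<in> hull3 a b z"
    using clique4_has_inner_vertex[OF z(1)] z(2) by (auto simp: insert_commute)
  then show False
  proof cases
    case 1
    then show False using * z w by blast
  next
    case 2
    then show False using *[of b c a] z w hull3_rotate[of a b c] by (auto dest: clique4_rotate)
  next
    case 3
    then show False using *[of c a b] z w hull3_rotate[of a b c] hull3_rotate[of b c a]
      by (auto dest: clique4_rotate)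
  qed
qed

end

section \<open>The graph\<close>

text \<open>
  The graph is a union of copies of one planar graph on the roles 0, ..., 8, indexed by a copy i of d, a
  face s of the K4 on a, b, c, d, and a copy k of x. Roles 0, 1, 2 are the corners of the face (0 is a),
  3 is the fourth vertex of the K4, 4 is x, roles 5 and 6 lie in two of the three faces around x, and 7
  and 8 are attached to them. The two orders of the pair VY are given by k < 3 and k \<ge> 3.
\<close>
datatype vertex = VA | VB | VC | VD nat | VY nat bool bool
  | VX nat bool nat | VW nat bool nat | VU nat bool nat

instance vertex :: countable
  by countable_datatype

text \<open>Roles 7 and 8 carry the same pair \<open>VY\<close> for all \<open>k\<close>, in an
  order that depends on \<open>k < 3\<close>; sharing the pair is what makes the copies of x
  conflict.\<close>

definition role :: "nat \<Rightarrow> bool \<Rightarrow> nat \<Rightarrow> nat \<Rightarrow> vertex" where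
  "role i s k r = [VA, if s then VC else VB, VD i, if s then VB else VC,
     VX i s k, VW i s k, VU i s k, VY i s (k < 3), VY i s (\<not> k < 3)] ! r"

text \<open>The K4, then role 4 over the face 0, 1, 2, roles 5 and 6 over two of the faces around
  role 4, and roles 7 and 8 closing triangles on the edges 5-4 and 6-4. Each edge is listed in one
  direction only.\<close>

definition role_edges :: "(nat \<times> nat) list" where
  "role_edges = [(0,1), (0,2), (0,3), (1,2), (1,3), (2,3), (4,0), (4,1), (4,2), (5,0), (5,2), (5,4),
     (6,0), (6,1), (6,4), (7,4), (7,5), (8,4), (8,6)]"

text \<open>Five copies of d, since at most two can be shown together with a, b, c and 5 > 2 * 2.
  Six copies of x, three for each order of the pair, since in a suitable face at most one can be
  shown together with a, b, c, d and 3 > 2 * 1.\<close>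

definition graph_vertices :: "nat set" where
  "graph_vertices = {to_nat (role i s k r) | i s k r. i < 5 \<and> k < 6 \<and> r < 9}"

definition graph_edges :: "nat set set" where
  "graph_edges = {{to_nat (role i s k r), to_nat (role i s k r')} | i s k r r'.
     i < 5 \<and> k < 6 \<and> (r, r') \<in> set role_edges}"

definition adjacent :: "vertex \<Rightarrow> vertex \<Rightarrow> bool" where
  "adjacent u v \<longleftrightarrow> {to_nat u, to_nat v} \<in> graph_edges"

lemma adjacent_sym: "adjacent u v \<Longrightarrow> adjacent v u"
  by (simp add: adjacent_def insert_commute)

lemma role_edges_bounds:
  assumes "(r, r') \<in> set role_edges"
  shows "r < 9" "r' < 9" "r \<noteq> r'"
  using assms by (auto simp: role_edges_def)

lemma inj_role: "inj_on (role i s k) {..<9}"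
proof -
  have "distinct [VA, if s then VC else VB, VD i, if s then VB else VC,
     VX i s k, VW i s k, VU i s k, VY i s (k < 3), VY i s (\<not> k < 3)]" by auto
  from inj_on_nth[OF this, of "{..<9}"] show ?thesis
    unfolding role_def[abs_def] by auto
qed

lemma simple_graph_graph: "simple_graph graph_vertices graph_edges"
proof -
  have "graph_vertices = (\<lambda>(i, s, k, r). to_nat (role i s k r)) ` ({..<5} \<times> UNIV \<times> {..<6} \<times> {..<9})"
    unfolding graph_vertices_def by (auto simp: image_iff) blast
  moreover have "finite ({..<5 :: nat} \<times> (UNIV :: bool set) \<times> {..<6 :: nat} \<times> {..<9 :: nat})"
    by (intro finite_cartesian_product) simp_all
  ultimately have "finite graph_vertices" by (metis finite_imageI)
  moreover have "\<exists>u v. u \<in> graph_vertices \<and> v \<in> graph_vertices \<and> u \<noteq> v \<and> e = {u, v}"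
    if "e \<in> graph_edges" for e
  proof -
    obtain i s k r r' where e: "e = {to_nat (role i s k r), to_nat (role i s k r')}" "i < 5" "k < 6"
      "(r, r') \<in> set role_edges"
      using \<open>e \<in> graph_edges\<close> unfolding graph_edges_def by blast
    then have "role i s k r \<noteq> role i s k r'"
      using inj_role[of i s k] role_edges_bounds[OF e(4)] by (auto dest: inj_onD)
    then show ?thesis
      using e role_edges_bounds[OF e(4)] unfolding graph_vertices_def by force
  qed
  ultimately show ?thesis unfolding simple_graph_def by blast
qed

lemma adjacent_irrefl: "\<not> adjacent u u"
  using simple_graph_graph unfolding adjacent_def simple_graph_def by (metis doubleton_eq_iff insert_absorb2)

lemma adjacent_role:
  assumes "i < 5" "k < 6" "(r, r') \<in> set role_edges"
  shows "adjacent (role i s k r) (role i s k r')"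
  using assms unfolding adjacent_def graph_edges_def by blast

lemma adjacent_base:
  assumes "i < 5"
  shows "adjacent VA VB" "adjacent VA VC" "adjacent VB VC"
    "adjacent (VD i) VA" "adjacent (VD i) VB" "adjacent (VD i) VC"
proof -
  have *: "adjacent (role i False 0 r) (role i False 0 r')" if "(r, r') \<in> set role_edges" for r r'
    using adjacent_role[OF assms _ that] by simp
  show "adjacent VA VB" using *[of 0 1] by (simp add: role_edges_def role_def)
  show "adjacent VA VC" using *[of 0 3] by (simp add: role_edges_def role_def)
  show "adjacent VB VC" using *[of 1 3] by (simp add: role_edges_def role_def)
  show "adjacent (VD i) VA" by (rule adjacent_sym) (use *[of 0 2] in \<open>simp add: role_edges_def role_def\<close>)
  show "adjacent (VD i) VB" by (rule adjacent_sym) (use *[of 1 2] in \<open>simp add: role_edges_def role_def\<close>)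
  show "adjacent (VD i) VC" using *[of 2 3] by (simp add: role_edges_def role_def)
qed

lemma adjacent_gadget:
  assumes "i < 5" "k < 6" "b = (if s then VC else VB)"
  shows "adjacent (VX i s k) VA" "adjacent (VX i s k) b" "adjacent (VX i s k) (VD i)"
    "adjacent (VW i s k) VA" "adjacent (VW i s k) (VD i)" "adjacent (VW i s k) (VX i s k)"
    "adjacent (VU i s k) VA" "adjacent (VU i s k) b" "adjacent (VU i s k) (VX i s k)"
    "adjacent (VY i s (k < 3)) (VX i s k)" "adjacent (VY i s (k < 3)) (VW i s k)"
    "adjacent (VY i s (\<not> k < 3)) (VX i s k)" "adjacent (VY i s (\<not> k < 3)) (VU i s k)"
  using adjacent_role[OF assms(1,2), of _ _ s]
  unfolding assms(3) by (fastforce simp: role_edges_def role_def)+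

lemma adjacent_vertices: "adjacent u v \<Longrightarrow> to_nat u \<in> graph_vertices"
proof -
  assume "adjacent u v"
  then obtain i s k r r' where "{to_nat u, to_nat v} = {to_nat (role i s k r), to_nat (role i s k r')}"
    "i < 5" "k < 6" "(r, r') \<in> set role_edges"
    unfolding adjacent_def graph_edges_def by blast
  then show ?thesis
    using role_edges_bounds[of r r'] unfolding graph_vertices_def doubleton_eq_iff by blast
qed

section \<open>No planar geometric storyplan\<close>

text \<open>Helly's theorem on the line: the largest left end lies in every interval, as its owner
  meets all of them.\<close>

lemma helly_intervals:
  fixes J :: "'a \<Rightarrow> nat set"
  assumes "finite F" "F \<noteq> {}" and iv: "\<And>v. v \<in> F \<Longrightarrow> \<exists>s e. J v = {s..e}"
    and meet: "\<And>u v. u \<in> F \<Longrightarrow> v \<in> F \<Longrightarrow> J u \<inter> J v \<noteq> {}"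
  shows "\<exists>t. \<forall>v\<in>F. t \<in> J v"
proof -
  obtain s e where J: "\<And>v. v \<in> F \<Longrightarrow> J v = {s v..e v}"
    using iv by metis
  define t where "t = Max (s ` F)"
  have "t \<in> s ` F" unfolding t_def using assms(1,2) by (intro Max_in) auto
  then obtain w where w: "w \<in> F" "t = s w" by blast
  have "t \<in> J v" if "v \<in> F" for v
  proof -
    have "s v \<le> t" unfolding t_def using that assms(1) by simp
    moreover have "s w \<le> e v" using meet[OF w(1) that] J[OF that] J[OF w(1)] by auto
    ultimately show ?thesis using J that w by auto
  qed
  then show ?thesis by blast
qed

text \<open>An interval that meets I without being contained in it contains an end point of I.\<close>
lemma exists_inner_interval:
  fixes J :: "'a \<Rightarrow> nat set"
  assumes "finite Z" "2 * m < card Z" "I = {s..e}"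
    and "\<And>z. z \<in> Z \<Longrightarrow> \<exists>s e. J z = {s..e}" "\<And>z. z \<in> Z \<Longrightarrow> J z \<inter> I \<noteq> {}"
    and "\<And>t. t \<in> I \<Longrightarrow> card {z \<in> Z. t \<in> J z} \<le> m"
  shows "\<exists>z\<in>Z. J z \<subseteq> I"
proof (rule ccontr)
  assume no: "\<not> ?thesis"
  have "s \<in> J z \<or> e \<in> J z" if z: "z \<in> Z" for z
  proof -
    obtain s' e' where "J z = {s'..e'}" using assms(4)[OF z] by blast
    then show ?thesis using no assms(3) assms(5)[OF z] z by force
  qed
  then have "Z = {z \<in> Z. s \<in> J z} \<union> {z \<in> Z. e \<in> J z}" by blast
  then have "card Z \<le> card {z \<in> Z. s \<in> J z} + card {z \<in> Z. e \<in> J z}"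
    by (metis (no_types, lifting) card_Un_le)
  \<comment> \<open>If \<open>I\<close> were empty, \<open>s\<close> and \<open>e\<close> would not
    be in it and the bound \<open>m\<close> would not apply to them.\<close>
  moreover have "I \<noteq> {}"
    using assms(2,5) by fastforce
  ultimately show False
    using assms(2,3) assms(6)[of s] assms(6)[of e] by auto
qed

lemma card_le_1_if_unique:
  assumes "\<And>x y. x \<in> S \<Longrightarrow> y \<in> S \<Longrightarrow> x = y"
  shows "card S \<le> 1"
  using assms by (metis One_nat_def card_le_Suc0_iff_eq card.infinite le0)

locale geometric_plan =
  fixes l :: nat and J :: "nat \<Rightarrow> nat set" and p :: "nat \<Rightarrow> point"
    and gam :: "nat set \<Rightarrow> real \<Rightarrow> point"
  assumes plan: "planar_geometric_storyplan graph_vertices graph_edges l J p gam"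
begin

section \<open>Frames of the geometric plan as straight-line drawings\<close>

definition life :: "vertex \<Rightarrow> nat set" where "life v = J (to_nat v)"

definition pos :: "vertex \<Rightarrow> point" where "pos v = p (to_nat v)"

definition shown :: "nat \<Rightarrow> vertex set" where
  "shown t = {v. to_nat v \<in> graph_vertices \<and> t \<in> life v}"

lemma story: "storyplan graph_vertices graph_edges l J p gam"
  using plan unfolding planar_geometric_storyplan_def planar_storyplan_def by blast

lemma life_interval: "to_nat v \<in> graph_vertices \<Longrightarrow> \<exists>s e. life v = {s..e} \<and> s \<le> e \<and> 1 \<le> s \<and> e \<le> l"
  using story unfolding storyplan_def life_def by metis

lemma life_meet: "adjacent u v \<Longrightarrow> life u \<inter> life v \<noteq> {}"
  using story unfolding storyplan_def adjacent_def life_def by blast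

text \<open>Lives of adjacent vertices meet, so by Helly a whole clique is shown at a single
  time.\<close>

lemma common_time:
  assumes "finite F" "F \<noteq> {}" "\<And>v. v \<in> F \<Longrightarrow> to_nat v \<in> graph_vertices"
    and "\<And>u v. u \<in> F \<Longrightarrow> v \<in> F \<Longrightarrow> u \<noteq> v \<Longrightarrow> adjacent u v \<or> adjacent v u"
  obtains t where "\<And>v. v \<in> F \<Longrightarrow> t \<in> life v"
proof -
  have "\<exists>t. \<forall>v\<in>F. t \<in> life v"
  proof (rule helly_intervals[OF assms(1,2)])
    show "\<exists>s e. life v = {s..e}" if "v \<in> F" for v
      using life_interval assms(3) that by blast
    show "life u \<inter> life v \<noteq> {}" if "u \<in> F" "v \<in> F" for u v
    proof (cases "u = v")
      case True
      then show ?thesis using life_interval[OF assms(3)[OF that(1)]] by auto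
    next
      case False
      then show ?thesis using life_meet assms(4) that by blast
    qed
  qed
  then show thesis using that by blast
qed

lemma straight_frame: "straight_drawing (shown t) adjacent pos"
proof (cases "shown t = {}")
  \<comment> \<open>Covers every \<open>t\<close> outside \<open>{1..l}\<close>: nothing is shown
    then.\<close>
  case True
  then show ?thesis
    by unfold_locales (auto intro: adjacent_sym simp: adjacent_irrefl)
next
  case False
  then have "t \<in> {1..l}"
    unfolding shown_def using life_interval by fastforce
  let ?W = "frame_vertices graph_vertices J t" and ?F = "frame_edges graph_vertices graph_edges J t"
  have drawing: "planar_drawing ?W ?F p gam"
    and straight: "\<And>e. e \<in> ?F \<Longrightarrow> \<exists>u v. e = {u, v} \<and> path_image (gam e) = closed_segment (p u) (p v)"
    using plan \<open>t \<in> {1..l}\<close> unfolding planar_geometric_storyplan_def planar_storyplan_def by blast+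
  then have "inj_on p ?W" and vertex_off: "\<And>e w. e \<in> ?F \<Longrightarrow> w \<in> ?W \<Longrightarrow> p w \<in> path_image (gam e) \<Longrightarrow> w \<in> e"
    unfolding planar_drawing_def simple_drawing_def is_drawing_def by blast+
  have W: "v \<in> shown t \<longleftrightarrow> to_nat v \<in> ?W" for v
    by (auto simp: shown_def frame_vertices_def life_def)
  have F: "{to_nat u, to_nat v} \<in> ?F" if "u \<in> shown t" "v \<in> shown t" "adjacent u v" for u v
    using that W unfolding frame_edges_def adjacent_def by auto
  have seg: "path_image (gam {to_nat u, to_nat v}) = closed_segment (pos u) (pos v)"
    if uv: "u \<in> shown t" "v \<in> shown t" "adjacent u v" for u v
  proof -
    obtain a b where ab: "{to_nat u, to_nat v} = {a, b}"
      "path_image (gam {to_nat u, to_nat v}) = closed_segment (p a) (p b)"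
      using straight[OF F[OF uv]] by blast
    from ab(1) have "a = to_nat u \<and> b = to_nat v \<or> a = to_nat v \<and> b = to_nat u"
      unfolding doubleton_eq_iff by blast
    then show ?thesis unfolding ab(2) pos_def by (auto simp only: closed_segment_commute)
  qed
  show ?thesis
  proof
    show "inj_on pos (shown t)"
    proof
      fix u v assume "u \<in> shown t" "v \<in> shown t" "pos u = pos v"
      then have "to_nat u = to_nat v"
        using inj_onD[OF \<open>inj_on p ?W\<close>, of "to_nat u" "to_nat v"] W unfolding pos_def by simp
      then show "u = v" by simp
    qed
    fix u v w
    assume *: "u \<in> shown t" "v \<in> shown t" "w \<in> shown t" "adjacent u v" "w \<noteq> u" "w \<noteq> v"
    have "to_nat w \<in> ?W" "to_nat w \<notin> {to_nat u, to_nat v}"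
      using * W by simp_all
    then show "pos w \<notin> closed_segment (pos u) (pos v)"
      using vertex_off[OF F[OF *(1,2,4)]] unfolding seg[OF *(1,2,4)] pos_def by blast
  next
    fix u v u' v'
    assume *: "u \<in> shown t" "v \<in> shown t" "u' \<in> shown t" "v' \<in> shown t" "adjacent u v" "adjacent u' v'"
      "{u, v} \<inter> {u', v'} = {}"
    let ?e = "{to_nat u, to_nat v}" and ?f = "{to_nat u', to_nat v'}"
    have "?e \<inter> ?f = {}" and "?e \<noteq> ?f" using *(7) by (auto simp: doubleton_eq_iff)
    then have "path_image (gam ?e) \<inter> path_image (gam ?f) \<subseteq> p ` {}"
      using drawing F[OF *(1,2,5)] F[OF *(3,4,6)] unfolding planar_drawing_def by metis
    then show "closed_segment (pos u) (pos v) \<inter> closed_segment (pos u') (pos v') = {}"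
      unfolding seg[OF *(1,2,5)] seg[OF *(3,4,6)] by simp
  qed (auto intro: adjacent_sym simp: adjacent_irrefl)
qed

lemma vertex_D: "i < 5 \<Longrightarrow> to_nat (VD i) \<in> graph_vertices"
  and vertex_A: "to_nat VA \<in> graph_vertices" and vertex_B: "to_nat VB \<in> graph_vertices"
  and vertex_C: "to_nat VC \<in> graph_vertices"
  using adjacent_vertices[OF adjacent_base(4)[of i]] adjacent_vertices[OF adjacent_base(1)[of 0]]
    adjacent_vertices[OF adjacent_base(3)[of 0]] adjacent_vertices[OF adjacent_sym[OF adjacent_base(3)[of 0]]]
  by simp_all

section \<open>Copies with confined lives, and the contradiction\<close>

definition base_life :: "nat set" where "base_life = life VA \<inter> life VB \<inter> life VC"

lemma base_life_interval: "\<exists>s e. base_life = {s..e}"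
proof -
  obtain s e s' e' s'' e'' where "life VA = {s..e}" "life VB = {s'..e'}" "life VC = {s''..e''}"
    using life_interval[OF vertex_A] life_interval[OF vertex_B] life_interval[OF vertex_C] by blast
  then show ?thesis unfolding base_life_def by auto
qed

lemma clique_ABCD:
  assumes "i < 5" "t \<in> base_life" "t \<in> life (VD i)"
  shows "straight_drawing.clique4 (shown t) adjacent VA VB VC (VD i)"
proof -
  interpret straight_drawing "shown t" adjacent pos by (rule straight_frame)
  show ?thesis
    using assms adjacent_base[OF assms(1)] vertex_A vertex_B vertex_C vertex_D
    unfolding clique4_def clique3_def unfolding shown_def base_life_def by auto
qed

text \<open>At most one copy is inside the triangle of a, b, c and at most one outside, by the two
  uniqueness lemmas.\<close>

lemma two_D_at_most:
  assumes "t \<in> base_life"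
  shows "card {i \<in> {..<5}. t \<in> life (VD i)} \<le> 2"
proof -
  interpret straight_drawing "shown t" adjacent pos by (rule straight_frame)
  let ?I = "{i \<in> {..<5}. t \<in> life (VD i)}"
  let ?in = "{i \<in> ?I. pos (VD i) \<in> hull3 VA VB VC}" and ?out = "{i \<in> ?I. pos (VD i) \<notin> hull3 VA VB VC}"
  have "i = j" if "i \<in> ?in" "j \<in> ?in" for i j
    using inside_unique[of VA VB VC "VD j" "VD i"] clique_ABCD assms that by auto
  then have "card ?in \<le> 1" by (rule card_le_1_if_unique)
  have "i = j" if "i \<in> ?out" "j \<in> ?out" for i j
    using outside_unique[of VA VB VC "VD j" "VD i"] clique_ABCD assms that by auto
  then have "card ?out \<le> 1" by (rule card_le_1_if_unique)
  have "?I = ?in \<union> ?out" by blast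
  then have "card ?I \<le> card ?in + card ?out" by (metis (no_types, lifting) card_Un_le)
  then show ?thesis using \<open>card ?in \<le> 1\<close> \<open>card ?out \<le> 1\<close> by linarith
qed

text \<open>Each copy forms a K4 with a, b, c, so its life meets \<open>base_life\<close>; five
  copies exceed twice the bound two.\<close>

lemma inner_D:
  obtains i where "i < 5" "life (VD i) \<subseteq> base_life"
proof -
  obtain s e where b: "base_life = {s..e}" using base_life_interval by blast
  have "\<exists>i\<in>{..<5}. life (VD i) \<subseteq> base_life"
  proof (rule exists_inner_interval[OF _ _ b, where m = 2])
    show "\<exists>s e. life (VD i) = {s..e}" if "i \<in> {..<5}" for i
      using that life_interval vertex_D by blast
    show "life (VD i) \<inter> base_life \<noteq> {}" if i: "i \<in> {..<5}" for i
    proof -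
      obtain t where "\<And>v. v \<in> {VA, VB, VC, VD i} \<Longrightarrow> t \<in> life v"
        by (rule common_time[of "{VA, VB, VC, VD i}"])
          (use i adjacent_base[of i] vertex_A vertex_B vertex_C vertex_D in auto)
      then show ?thesis unfolding base_life_def by blast
    qed
  qed (use two_D_at_most in auto)
  then show thesis using that by blast
qed

lemma contradiction: False
proof -
  obtain i where i: "i < 5" "life (VD i) \<subseteq> base_life" by (rule inner_D)
  have base: "t \<in> base_life" "t \<in> life VA" "t \<in> life VB" "t \<in> life VC" if "t \<in> life (VD i)" for t
    using i(2) that unfolding base_life_def by blast+
  obtain t0 where t0: "t0 \<in> life (VD i)"
    using life_interval[OF vertex_D[OF i(1)]] by force
  note adj = adjacent_base[OF i(1)]
  text \<open>Of the two faces carrying gadgets, take one that contains the inner vertex of the drawn K4.\<close>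
  obtain s b c where s: "b = (if s then VC else VB)" "c = (if s then VB else VC)"
    and inner: "pos VA \<in> convex hull {pos b, pos (VD i), pos c}
      \<or> pos b \<in> convex hull {pos VA, pos (VD i), pos c} \<or> pos (VD i) \<in> convex hull {pos VA, pos b, pos c}"
  proof -
    interpret straight_drawing "shown t0" adjacent pos by (rule straight_frame)
    show thesis
    proof (cases "pos VC \<in> hull3 VA VB (VD i)")
      case True
      then show thesis by (intro that[of VC True VB]) (simp_all add: insert_commute)
    next
      case False
      then show thesis
        using clique4_has_inner_vertex[OF clique_ABCD[OF i(1) base(1)[OF t0] t0]]
        by (intro that[of VB False VC]) (auto simp: insert_commute)
    qed
  qed
  have clique_face: "straight_drawing.clique4 (shown t) adjacent VA b (VD i) c" if "t \<in> life (VD i)" for t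
  proof -
    interpret straight_drawing "shown t" adjacent pos by (rule straight_frame)
    show ?thesis
      using clique4_permute[OF clique_ABCD[OF i(1) base(1)[OF that] that]] unfolding s by simp
  qed
  have clique_X: "straight_drawing.clique4 (shown t) adjacent VA b (VD i) (VX i s k)"
    if "t \<in> life (VD i)" "t \<in> life (VX i s k)" "k < 6" for t k
  proof -
    interpret straight_drawing "shown t" adjacent pos by (rule straight_frame)
    show ?thesis
      using clique_face[OF that(1)] adjacent_gadget(1-3)[OF i(1) that(3) s(1)]
        adjacent_vertices that(2)
      unfolding clique4_def unfolding shown_def by blast
  qed
  \<comment> \<open>The inner vertex of the K4 is a corner of the face. In the triangle of
    \<open>c\<close> and the other two corners, x is adjacent to all but \<open>c\<close>, so
    \<open>neighbour_in_face\<close> puts it in the face opposite \<open>c\<close>. Positions are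
    fixed, so \<open>inner\<close> holds at every time.\<close>
  have X_inside: "pos (VX i s k) \<in> convex hull {pos VA, pos b, pos (VD i)}"
    if t: "t \<in> life (VD i)" "t \<in> life (VX i s k)" and k: "k < 6" for t k
  proof -
    interpret straight_drawing "shown t" adjacent pos by (rule straight_frame)
    have cl: "clique4 VA b (VD i) c" "clique4 VA b (VD i) (VX i s k)" "VX i s k \<noteq> c"
      using clique_face clique_X t k s by auto
    then have X: "VX i s k \<in> shown t" "adjacent (VX i s k) VA" "adjacent (VX i s k) b" "adjacent (VX i s k) (VD i)"
      unfolding clique4_def by auto
    from inner show ?thesis
    proof (elim disjE)
      assume "pos VA \<in> hull3 b (VD i) c"
      then show ?thesis
        using neighbour_in_face[of b c "VD i" VA "VX i s k"] clique4_permute[OF cl(1)] cl(3) X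
        by (simp add: insert_commute)
    next
      assume "pos b \<in> hull3 VA (VD i) c"
      then show ?thesis
        using neighbour_in_face[of VA c "VD i" b "VX i s k"] clique4_permute[OF cl(1)] cl(3) X
        by (simp add: insert_commute)
    next
      assume "pos (VD i) \<in> hull3 VA b c"
      then show ?thesis
        using neighbour_in_face[of VA c b "VD i" "VX i s k"] clique4_permute[OF cl(1)] cl(3) X
        by (simp add: insert_commute)
    qed
  qed
  \<comment> \<open>Two copies of x shown together with d would both be inside the face, against
    \<open>inside_unique\<close>; three copies exceed twice the bound one.\<close>
  have contained: "\<exists>k\<in>K. life (VX i s k) \<subseteq> life (VD i)" if K: "K \<subseteq> {..<6}" "card K = 3" for K
  proof -
    obtain u e where life_D: "life (VD i) = {u..e}" using life_interval[OF vertex_D[OF i(1)]] by blast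
    show ?thesis
    proof (rule exists_inner_interval[OF _ _ life_D, where m = 1])
      show "finite K" using K finite_subset by blast
      fix k assume "k \<in> K"
      then have "k < 6" using K by blast
      note adj_X = adjacent_gadget[OF i(1) \<open>k < 6\<close> s(1)]
      show "\<exists>s' e. life (VX i s k) = {s'..e}"
        using life_interval adj_X adjacent_vertices by blast
      obtain t where "\<And>v. v \<in> {VX i s k, VA, b, VD i} \<Longrightarrow> t \<in> life v"
        by (rule common_time[of "{VX i s k, VA, b, VD i}"])
          (use adj adj_X(1-3) s adjacent_vertices[OF adj_X(1)] vertex_A vertex_B vertex_C vertex_D[OF i(1)]
            in \<open>auto split: if_splits dest: adjacent_sym\<close>)
      then show "life (VX i s k) \<inter> life (VD i) \<noteq> {}" by blast
    next
      fix t assume t: "t \<in> life (VD i)"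
      interpret straight_drawing "shown t" adjacent pos by (rule straight_frame)
      have "k = k'" if "k \<in> {k \<in> K. t \<in> life (VX i s k)}" "k' \<in> {k \<in> K. t \<in> life (VX i s k)}" for k k'
      proof -
        have "k < 6" "k' < 6" "t \<in> life (VX i s k)" "t \<in> life (VX i s k')" using that K by auto
        then show ?thesis
          using inside_unique[of VA b "VD i" "VX i s k'" "VX i s k"] clique_X[OF t] X_inside[OF t] by blast
      qed
      then show "card {k \<in> K. t \<in> life (VX i s k)} \<le> 1" by (rule card_le_1_if_unique)
    qed (use K in simp)
  qed
  \<comment> \<open>The product depends on \<open>k\<close> only through the order of the pair, so
    the two groups of copies will give opposite signs.\<close>
  have turn_sign: "turn (pos VA) (pos b) (pos (VD i)) *
      turn (pos VA) (pos (VY i s (\<not> k < 3))) (pos (VY i s (k < 3))) > 0"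
    if k: "k < 6" "life (VX i s k) \<subseteq> life (VD i)" for k
  proof -
    note adj_X = adjacent_gadget[OF i(1) k(1) s(1)]
    \<comment> \<open>Treats both halves at once: \<open>f\<close> is the corner besides a to which
      \<open>w\<close> is joined, \<open>g\<close> the third corner. The triangle of x,
      \<open>w\<close>, \<open>y\<close> has a common time, when d and hence a, b, c are shown too.
      Then \<open>w\<close> lies in the face a x f, and \<open>y\<close> follows it there.\<close>
    have Y_in_face: "pos y \<in> convex hull {pos VA, pos (VX i s k), pos f} \<and>
        pos y \<notin> closed_segment (pos VA) (pos (VX i s k))"
      if w: "adjacent w VA" "adjacent w f" "adjacent w (VX i s k)" and y: "adjacent y (VX i s k)" "adjacent y w"
        and f: "(f = VD i \<and> g = b) \<or> (f = b \<and> g = VD i)" and ne: "y \<notin> {VA, VB, VC, VD i}" "w \<notin> {VA, VB, VC, VD i}"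
      for w y f g
    proof -
      have W: "to_nat (VX i s k) \<in> graph_vertices" "to_nat w \<in> graph_vertices" "to_nat y \<in> graph_vertices"
        using adjacent_vertices adj_X(1) w y by blast+
      obtain t where t': "\<And>v. v \<in> {VX i s k, w, y} \<Longrightarrow> t \<in> life v"
        by (rule common_time[of "{VX i s k, w, y}"]) (use w y W in auto)
      then have t: "t \<in> life (VD i)" using k by blast
      interpret straight_drawing "shown t" adjacent pos by (rule straight_frame)
      have cl: "clique4 VA g f (VX i s k)" "VX i s k \<in> shown t" "w \<in> shown t" "y \<in> shown t"
        using clique_X[OF t _ k(1)] t' f W clique4_permute(2)[of VA b "VD i" "VX i s k"] unfolding shown_def by auto
      have "pos (VX i s k) \<in> hull3 VA g f"
        using X_inside[OF t _ k(1)] t' f by (auto simp: insert_commute)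
      moreover have "w \<noteq> g" using ne f s by (auto split: if_splits)
      ultimately have "pos w \<in> hull3 VA (VX i s k) f"
        using neighbour_in_face[of VA g f "VX i s k" w] cl w by blast
      moreover have "clique3 VA (VX i s k) f"
        using cl adj_sym unfolding clique4_def clique3_def by blast
      moreover have "w \<noteq> VX i s k" "y \<noteq> VX i s k" using w y adj_irrefl by blast+
      moreover have "w \<notin> {VA, f}" "y \<notin> {VA, f}" using ne f s by (auto split: if_splits)
      ultimately have "pos y \<in> hull3 VA (VX i s k) f"
        using stays_inside[of VA "VX i s k" f w y] cl y adj_sym by blast
      moreover have "pos y \<notin> closed_segment (pos VA) (pos (VX i s k))"
        using off_edge[of VA "VX i s k" y] cl adj_X(1) adj_sym \<open>y \<notin> {VA, f}\<close> \<open>y \<noteq> VX i s k\<close>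
        unfolding clique4_def clique3_def by blast
      ultimately show ?thesis by blast
    qed
    obtain t where t: "t \<in> life (VX i s k)" "t \<in> life (VD i)"
      using life_interval[OF adjacent_vertices[OF adj_X(1)]] k(2) by force
    interpret straight_drawing "shown t" adjacent pos by (rule straight_frame)
    have "turn (pos VA) (pos b) (pos (VD i)) \<noteq> 0"
      using clique3_turn clique_face[OF t(2)] unfolding clique4_def by blast
    moreover have "pos (VY i s (k < 3)) \<in> hull3 VA (VX i s k) (VD i) \<and>
        pos (VY i s (k < 3)) \<notin> closed_segment (pos VA) (pos (VX i s k))"
      by (rule Y_in_face[of "VW i s k" "VD i" "VY i s (k < 3)" b]) (use adj_X in simp_all)
    moreover have "pos (VY i s (\<not> k < 3)) \<in> hull3 VA (VX i s k) b \<and>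
        pos (VY i s (\<not> k < 3)) \<notin> closed_segment (pos VA) (pos (VX i s k))"
      by (rule Y_in_face[of "VU i s k" b "VY i s (\<not> k < 3)" "VD i"]) (use adj_X in simp_all)
    ultimately show ?thesis
      using X_inside[OF t(2,1) k(1)] by (intro turn_across_ray) auto
  qed
  \<comment> \<open>One confined copy from each group of three: the same two points are required in
    both orders.\<close>
  obtain k k' where "k < 3" "life (VX i s k) \<subseteq> life (VD i)" "k' \<in> {3..<6}" "life (VX i s k') \<subseteq> life (VD i)"
    using contained[of "{..<3}"] contained[of "{3..<6}"] by (force simp: subset_iff)
  then have "turn (pos VA) (pos b) (pos (VD i)) * turn (pos VA) (pos (VY i s False)) (pos (VY i s True)) > 0"
    "turn (pos VA) (pos b) (pos (VD i)) * turn (pos VA) (pos (VY i s True)) (pos (VY i s False)) > 0"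
    using turn_sign[of k] turn_sign[of k'] by simp_all
  then show False
    using turn_swap[of "pos VA" "pos (VY i s True)" "pos (VY i s False)"] by simp
qed

end

section \<open>A planar storyplan\<close>

text \<open>\<open>turn a b\<close> is affine in its third argument.\<close>

lemma turn_on_segment:
  assumes "z \<in> closed_segment c d"
  obtains u where "0 \<le> u" "u \<le> 1" "z = (1 - u) *\<^sub>R c + u *\<^sub>R d"
    "turn a b z = (1 - u) * turn a b c + u * turn a b d"
proof -
  obtain u where u: "0 \<le> u" "u \<le> 1" "z = (1 - u) *\<^sub>R c + u *\<^sub>R d"
    using assms unfolding in_segment by blast
  moreover have "turn a b z = (1 - u) * turn a b c + u * turn a b d"
    unfolding u(3) by (simp add: turn_def algebra_simps)
  ultimately show thesis using that by blast
qed

lemma turn_0_on_segment: "z \<in> closed_segment a b \<Longrightarrow> turn a b z = 0"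
  by (rule turn_on_segment[of z a b a b]) (auto simp: turn_def)

text \<open>The ends c and d are strictly on one side of the line ab, hence so is the segment
  between them.\<close>

lemma segments_disjoint:
  assumes "turn a b c * turn a b d > 0"
  shows "closed_segment a b \<inter> closed_segment c d = {}"
proof -
  have False if ab: "z \<in> closed_segment a b" and cd: "z \<in> closed_segment c d" for z
  proof -
    obtain u where u: "0 \<le> u" "u \<le> 1" "turn a b z = (1 - u) * turn a b c + u * turn a b d"
      using turn_on_segment[OF cd] by metis
    \<comment> \<open>Multiplying by \<open>turn a b c\<close> avoids distinguishing the two
      sides.\<close>
    have "turn a b c * turn a b z = (1 - u) * (turn a b c)\<^sup>2 + u * (turn a b c * turn a b d)"
      unfolding u(3) by (simp add: algebra_simps power2_eq_square)
    moreover have "(1 - u) * (turn a b c)\<^sup>2 + u * (turn a b c * turn a b d) > 0"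
    proof (cases "u = 0")
      case True
      then show ?thesis using assms by auto
    next
      case False
      then have "u * (turn a b c * turn a b d) > 0" using u(1) assms by simp
      then show ?thesis using u(2) by (intro add_nonneg_pos) simp_all
    qed
    ultimately show False using turn_0_on_segment[OF ab] by simp
  qed
  then show ?thesis by blast
qed

text \<open>Starting on the line ab and moving towards c, \<open>turn a b\<close> is proportional to
  the parameter, so it vanishes at the start only.\<close>

lemma segments_meet_at_endpoint:
  assumes "turn a b c \<noteq> 0"
  shows "closed_segment a b \<inter> closed_segment a c \<subseteq> {a}" "closed_segment a b \<inter> closed_segment b c \<subseteq> {b}"
proof -
  have ends: "turn a b a = 0" "turn a b b = 0" by (simp_all add: turn_def)
  show "closed_segment a b \<inter> closed_segment a c \<subseteq> {a}"
  proof
    fix z assume z: "z \<in> closed_segment a b \<inter> closed_segment a c"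
    then obtain u where "z = (1 - u) *\<^sub>R a + u *\<^sub>R c" "turn a b z = (1 - u) * turn a b a + u * turn a b c"
      using turn_on_segment[of z a c] by blast
    then show "z \<in> {a}" using turn_0_on_segment[of z a b] z assms ends by simp
  qed
  show "closed_segment a b \<inter> closed_segment b c \<subseteq> {b}"
  proof
    fix z assume z: "z \<in> closed_segment a b \<inter> closed_segment b c"
    then obtain u where "z = (1 - u) *\<^sub>R b + u *\<^sub>R c" "turn a b z = (1 - u) * turn a b b + u * turn a b c"
      using turn_on_segment[of z b c] by blast
    then show "z \<in> {b}" using turn_0_on_segment[of z a b] z assms ends by simp
  qed
qed

text \<open>
  Positions of the roles for k < 3 and for k \<ge> 3, found by random search. Entry 9 is the bend of the
  edge between roles 4 and 0, the only curve that is not a segment.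
\<close>
definition layout :: "bool \<Rightarrow> (int \<times> int) list" where
  "layout f = (if f
     then [(0, 24), (-24, -8), (0, 0), (24, -8), (-16, -3), (-2, 14), (-11, 6), (-12, 1), (-2, 19), (-4, 12)]
     else [(0, 24), (-24, -8), (0, 0), (24, -8), (-7, 2), (-4, 8), (-13, 5), (-2, 19), (-12, 1), (-8, 5)])"

text \<open>Splits the bent edge at its bend, so that only segments have to be compared.\<close>

definition pieces :: "nat \<times> nat \<Rightarrow> (nat \<times> nat) list" where
  "pieces e = (if e = (4, 0) then [(4, 9), (9, 0)] else [e])"

definition all_pieces :: "(nat \<times> nat) list" where
  "all_pieces = concat (map pieces role_edges)"

definition iturn :: "int \<times> int \<Rightarrow> int \<times> int \<Rightarrow> int \<times> int \<Rightarrow> int" where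
  "iturn a b c = (fst b - fst a) * (snd c - snd a) - (snd b - snd a) * (fst c - fst a)"

definition layout_pieces :: "bool \<Rightarrow> ((int \<times> int) \<times> (int \<times> int)) list" where
  "layout_pieces f = map (\<lambda>(u, v). (layout f ! u, layout f ! v)) all_pieces"

definition general_position :: "(int \<times> int) list \<Rightarrow> ((int \<times> int) \<times> (int \<times> int)) list \<Rightarrow> bool" where
  "general_position L S \<longleftrightarrow>
     list_all (\<lambda>(u, v). list_all (\<lambda>w. w = u \<or> w = v \<or> iturn u v w \<noteq> 0) L) S"

text \<open>Uses the sufficient condition of \<open>segments_disjoint\<close>, with either piece as
  the separating line, over the integers so that it can be evaluated. Pieces with a common end are
  left to \<open>general_position\<close>.\<close>

definition uncrossed :: "((int \<times> int) \<times> (int \<times> int)) list \<Rightarrow> bool" where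
  "uncrossed S \<longleftrightarrow>
     list_all (\<lambda>(u, v). list_all (\<lambda>(u', v'). u = u' \<or> u = v' \<or> v = u' \<or> v = v' \<or>
       iturn u v u' * iturn u v v' > 0 \<or> iturn u' v' u * iturn u' v' v > 0) S) S"

lemma general_positionD:
  assumes "general_position L S" "(u, v) \<in> set S" "w \<in> set L"
  shows "w = u \<or> w = v \<or> iturn u v w \<noteq> 0"
  using bspec[OF assms(1)[unfolded general_position_def list_all_iff] assms(2)] assms(3) by simp

lemma uncrossedD:
  assumes "uncrossed S" "(u, v) \<in> set S" "(u', v') \<in> set S" "{u, v} \<inter> {u', v'} = {}"
  shows "iturn u v u' * iturn u v v' > 0 \<or> iturn u' v' u * iturn u' v' v > 0"
  using bspec[OF bspec[OF assms(1)[unfolded uncrossed_def list_all_iff] assms(2), simplified] assms(3)]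
    assms(4) by auto

section \<open>Verification of the two layouts\<close>

lemma all_pieces_eq: "all_pieces = [(0,1), (0,2), (0,3), (1,2), (1,3), (2,3), (4,9), (9,0), (4,1), (4,2),
    (5,0), (5,2), (5,4), (6,0), (6,1), (6,4), (7,4), (7,5), (8,4), (8,6)]"
  by (simp add: all_pieces_def role_edges_def pieces_def)

lemma layout_True: "layout True =
    [(0, 24), (-24, -8), (0, 0), (24, -8), (-16, -3), (-2, 14), (-11, 6), (-12, 1), (-2, 19), (-4, 12)]"
  and layout_False: "layout False =
    [(0, 24), (-24, -8), (0, 0), (24, -8), (-7, 2), (-4, 8), (-13, 5), (-2, 19), (-12, 1), (-8, 5)]"
  by (simp_all add: layout_def)

lemma pieces_True: "layout_pieces True = 
   [((0, 24), (-24, -8)), ((0, 24), (0, 0)), ((0, 24), (24, -8)), ((-24, -8), (0, 0)),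
    ((-24, -8), (24, -8)), ((0, 0), (24, -8)), ((-16, -3), (-4, 12)), ((-4, 12), (0, 24)),
    ((-16, -3), (-24, -8)), ((-16, -3), (0, 0)), ((-2, 14), (0, 24)), ((-2, 14), (0, 0)),
    ((-2, 14), (-16, -3)), ((-11, 6), (0, 24)), ((-11, 6), (-24, -8)), ((-11, 6), (-16, -3)),
    ((-12, 1), (-16, -3)), ((-12, 1), (-2, 14)), ((-2, 19), (-16, -3)), ((-2, 19), (-11, 6))]"
  and pieces_False: "layout_pieces False = 
   [((0, 24), (-24, -8)), ((0, 24), (0, 0)), ((0, 24), (24, -8)), ((-24, -8), (0, 0)),
    ((-24, -8), (24, -8)), ((0, 0), (24, -8)), ((-7, 2), (-8, 5)), ((-8, 5), (0, 24)),
    ((-7, 2), (-24, -8)), ((-7, 2), (0, 0)), ((-4, 8), (0, 24)), ((-4, 8), (0, 0)),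
    ((-4, 8), (-7, 2)), ((-13, 5), (0, 24)), ((-13, 5), (-24, -8)), ((-13, 5), (-7, 2)),
    ((-2, 19), (-7, 2)), ((-2, 19), (-4, 8)), ((-12, 1), (-7, 2)), ((-12, 1), (-13, 5))]"
  by (simp_all add: layout_pieces_def all_pieces_eq layout_True layout_False)

lemma general_position_layout: "general_position (layout f) (layout_pieces f)"
proof -
  have "general_position (layout True) (layout_pieces True)"
    unfolding layout_True pieces_True by code_simp
  moreover have "general_position (layout False) (layout_pieces False)"
    unfolding layout_False pieces_False by code_simp
  ultimately show ?thesis by (cases f) simp_all
qed

lemma uncrossed_layout: "uncrossed (layout_pieces f)"
proof -
  have "uncrossed (layout_pieces True)" unfolding pieces_True by code_simp
  moreover have "uncrossed (layout_pieces False)" unfolding pieces_False by code_simp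
  ultimately show ?thesis by (cases f) simp_all
qed

lemma distinct_layout: "distinct (layout f)"
  by (simp add: layout_def)

lemma role_edges_oriented:
  assumes "(a, b) \<in> set role_edges"
  shows "(b, a) \<notin> set role_edges"
proof -
  have "\<forall>(a, b)\<in>set role_edges. (b, a) \<notin> set role_edges"
    by (simp add: role_edges_def)
  then show ?thesis using assms by blast
qed

text \<open>The bend 9 occurs in the pieces of the edge (4, 0) only, so a common end of pieces of
  different edges is a role and an end of both edges.\<close>

lemma pieces_incidence:
  assumes e: "e \<in> set role_edges" "e' \<in> set role_edges" "e \<noteq> e'"
    and p: "(u, v) \<in> set (pieces e)" "(u', v') \<in> set (pieces e')"
  shows "{u, v} \<noteq> {u', v'}" "{u, v} \<inter> {u', v'} \<subseteq> {fst e, snd e} \<inter> {fst e', snd e'}"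
proof -
  obtain a b c d where ab: "e = (a, b)" and cd: "e' = (c, d)" by (cases e; cases e')
  have lt: "a < 9" "b < 9" "c < 9" "d < 9"
    using role_edges_bounds e unfolding ab cd by blast+
  have "{a, b} \<noteq> {c, d}"
    using e role_edges_oriented unfolding ab cd by (auto simp: doubleton_eq_iff)
  then show "{u, v} \<noteq> {u', v'}"
    using lt p e(3) unfolding ab cd pieces_def by (auto simp: doubleton_eq_iff split: if_splits)
  show "{u, v} \<inter> {u', v'} \<subseteq> {fst e, snd e} \<inter> {fst e', snd e'}"
    using lt p e(3) unfolding ab cd pieces_def by (auto split: if_splits)
qed

text \<open>For \<open>s\<close> the layout is reflected in the vertical axis. Roles 0 and 2 lie on
  the axis and 1 and 3 are mirror images, so a and d keep their places while b and c exchange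
  roles.\<close>

definition site :: "bool \<Rightarrow> bool \<Rightarrow> nat \<Rightarrow> point" where
  "site s f r = (let (x, y) = layout f ! r in (real_of_int (if s then - x else x), real_of_int y))"

lemma turn_site:
  "turn (site s f u) (site s f v) (site s f w)
    = (if s then - 1 else 1) * real_of_int (iturn (layout f ! u) (layout f ! v) (layout f ! w))"
  by (simp add: turn_def site_def iturn_def Let_def case_prod_beta algebra_simps)

lemma layout_piece: "(u, v) \<in> set all_pieces \<Longrightarrow> (layout f ! u, layout f ! v) \<in> set (layout_pieces f)"
  unfolding layout_pieces_def by force

lemma all_pieces_bounds:
  assumes "(u, v) \<in> set all_pieces"
  shows "u < 10" "v < 10" "u \<noteq> v"
  using assms by (auto simp: all_pieces_eq)

lemma layout_nth_eq_iff: "u < 10 \<Longrightarrow> v < 10 \<Longrightarrow> layout f ! u = layout f ! v \<longleftrightarrow> u = v"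
  using distinct_layout[of f] by (subst nth_eq_iff_index_eq) (auto simp: layout_def)

lemma turn_site_nonzero:
  assumes "(u, v) \<in> set all_pieces" "w < 10" "w \<noteq> u" "w \<noteq> v"
  shows "turn (site s f u) (site s f v) (site s f w) \<noteq> 0"
proof -
  have "layout f ! w \<in> set (layout f)" using assms(2) by (intro nth_mem) (simp add: layout_def)
  then have "iturn (layout f ! u) (layout f ! v) (layout f ! w) \<noteq> 0"
    using general_positionD[OF general_position_layout layout_piece[OF assms(1)]] assms(2-4)
      all_pieces_bounds[OF assms(1)] layout_nth_eq_iff[of w _ f] by blast
  then show ?thesis unfolding turn_site by simp
qed

abbreviation piece :: "bool \<Rightarrow> bool \<Rightarrow> nat \<times> nat \<Rightarrow> point set" where
  "piece s f g \<equiv> closed_segment (site s f (fst g)) (site s f (snd g))"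

lemma pieces_disjoint:
  assumes "(u, v) \<in> set all_pieces" "(u', v') \<in> set all_pieces" "{u, v} \<inter> {u', v'} = {}"
  shows "piece s f (u, v) \<inter> piece s f (u', v') = {}"
proof -
  have "{layout f ! u, layout f ! v} \<inter> {layout f ! u', layout f ! v'} = {}"
    using assms(3) all_pieces_bounds[OF assms(1)] all_pieces_bounds[OF assms(2)] layout_nth_eq_iff by auto
  note uncrossedD[OF uncrossed_layout layout_piece[OF assms(1)] layout_piece[OF assms(2)] this]
  then have "turn (site s f u) (site s f v) (site s f u') * turn (site s f u) (site s f v) (site s f v') > 0
     \<or> turn (site s f u') (site s f v') (site s f u) * turn (site s f u') (site s f v') (site s f v) > 0"
    unfolding turn_site by (cases s) (simp_all flip: of_int_mult)
  then show ?thesis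
    using segments_disjoint by (metis Int_commute fst_conv snd_conv)
qed

text \<open>By general position, the end of the second piece other than \<open>w\<close> is off the
  line of the first. This also serves for the two halves of the bent edge.\<close>

lemma pieces_adjacent:
  assumes "(u, v) \<in> set all_pieces" "u' < 10" "v' < 10" "u' \<noteq> v'" "{u, v} \<noteq> {u', v'}"
    and "w \<in> {u, v}" "w \<in> {u', v'}"
  shows "piece s f (u, v) \<inter> piece s f (u', v') \<subseteq> {site s f w}"
proof -
  obtain y where y: "{u', v'} = {w, y}" "y < 10" "y \<noteq> u" "y \<noteq> v"
    using assms by (auto simp: doubleton_eq_iff)
  then have eq: "piece s f (u', v') = closed_segment (site s f w) (site s f y)"
    by (auto simp: doubleton_eq_iff closed_segment_commute)
  have "piece s f (u, v) \<inter> closed_segment (site s f w) (site s f y) \<subseteq> {site s f w}"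
    using segments_meet_at_endpoint[OF turn_site_nonzero[OF assms(1) y(2-4), of s f]] assms(6) by auto
  then show ?thesis unfolding eq .
qed

lemma pieces_ends:
  "e \<in> set role_edges \<Longrightarrow> (u, v) \<in> set (pieces e) \<Longrightarrow> u \<in> {fst e, snd e, 9} \<and> v \<in> {fst e, snd e, 9}"
  by (auto simp: pieces_def split: if_splits)

definition curve_image :: "bool \<Rightarrow> bool \<Rightarrow> nat \<times> nat \<Rightarrow> point set" where
  "curve_image s f e = (\<Union>g\<in>set (pieces e). piece s f g)"

lemma pieces_in_all: "e \<in> set role_edges \<Longrightarrow> g \<in> set (pieces e) \<Longrightarrow> g \<in> set all_pieces"
  unfolding all_pieces_def by auto

text \<open>Two pieces are disjoint or meet only in a common end, which
  \<open>pieces_incidence\<close> traces back to both edges.\<close>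

lemma curve_images_meet:
  assumes "e \<in> set role_edges" "e' \<in> set role_edges" "e \<noteq> e'"
  shows "curve_image s f e \<inter> curve_image s f e' \<subseteq> site s f ` ({fst e, snd e} \<inter> {fst e', snd e'})"
proof -
  have "piece s f g \<inter> piece s f g' \<subseteq> site s f ` ({fst e, snd e} \<inter> {fst e', snd e'})"
    if g: "g \<in> set (pieces e)" and g': "g' \<in> set (pieces e')" for g g'
  proof -
    obtain u v u' v' where uv: "g = (u, v)" "g' = (u', v')" by (cases g; cases g')
    have all: "(u, v) \<in> set all_pieces" "(u', v') \<in> set all_pieces"
      using pieces_in_all assms g g' uv by auto
    note incidence = pieces_incidence[OF assms g[unfolded uv] g'[unfolded uv]]
    show ?thesis
    proof (cases "{u, v} \<inter> {u', v'} = {}")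
      case True
      then show ?thesis using pieces_disjoint[OF all] uv by simp
    next
      case False
      then obtain w where w: "w \<in> {u, v}" "w \<in> {u', v'}" by blast
      then have "piece s f g \<inter> piece s f g' \<subseteq> {site s f w}"
        using pieces_adjacent[OF all(1) all_pieces_bounds[OF all(2)] incidence(1) w] uv by simp
      then show ?thesis using w incidence(2) by blast
    qed
  qed
  then show ?thesis unfolding curve_image_def by fast
qed

lemma site_off_curve:
  assumes "e \<in> set role_edges" "w < 9" "site s f w \<in> curve_image s f e"
  shows "w \<in> {fst e, snd e}"
proof (rule ccontr)
  assume w: "w \<notin> {fst e, snd e}"
  obtain u v where g: "(u, v) \<in> set (pieces e)" "site s f w \<in> piece s f (u, v)"
    using assms(3) unfolding curve_image_def by auto
  then have "turn (site s f u) (site s f v) (site s f w) = 0"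
    by (simp add: turn_0_on_segment)
  \<comment> \<open>Being below 9, \<open>w\<close> is not the bend.\<close>
  moreover have "w \<noteq> u" "w \<noteq> v" using pieces_ends[OF assms(1) g(1)] w assms(2) by auto
  ultimately show False
    using turn_site_nonzero[OF pieces_in_all[OF assms(1) g(1)], of w] assms(2) by auto
qed

lemma inj_site: "inj_on (site s f) {..<10}"
proof
  fix u v assume uv: "u \<in> {..<10}" "v \<in> {..<10}" "site s f u = site s f v"
  then have "layout f ! u = layout f ! v"
    by (auto simp: site_def Let_def case_prod_beta prod_eq_iff split: if_splits)
  then show "u = v" using layout_nth_eq_iff uv by simp
qed

text \<open>Copies are never shown together and may share their position. The two faces are mirror images.\<close>
fun vertex_site :: "vertex \<Rightarrow> point" where
  "vertex_site VA = site False True 0"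
| "vertex_site VB = site False True 1"
| "vertex_site VC = site False True 3"
| "vertex_site (VD i) = site False True 2"
| "vertex_site (VX i s k) = site s (k < 3) 4"
| "vertex_site (VW i s k) = site s (k < 3) 5"
| "vertex_site (VU i s k) = site s (k < 3) 6"
| "vertex_site (VY i s f) = site s f 7"

lemma less_9_cases:
  assumes "r < (9::nat)"
  shows "r = 0 \<or> r = 1 \<or> r = 2 \<or> r = 3 \<or> r = 4 \<or> r = 5 \<or> r = 6 \<or> r = 7 \<or> r = 8"
  using assms by presburger

text \<open>The two layouts agree in entries 0 to 3 and exchange entries 7 and 8, so each
  \<open>VY\<close> keeps one place in both orders.\<close>

lemma vertex_site_role:
  assumes "r < 9"
  shows "vertex_site (role i s k r) = site s (k < 3) r"
  using less_9_cases[OF assms]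
  by (elim disjE) (simp_all add: role_def site_def layout_def)

section \<open>Positions and curves of the storyplan\<close>

definition position :: "nat \<Rightarrow> point" where
  "position = vertex_site \<circ> from_nat"

text \<open>An edge is a bare set of codes: a bent one is recognized by removing \<open>VA\<close>
  and decoding what remains. The others run from the smaller to the larger code, whatever their
  direction in \<open>role_edges\<close>.\<close>

definition curve :: "nat set \<Rightarrow> real \<Rightarrow> point" where
  "curve e = (case (to_nat VA \<in> e, from_nat (the_elem (e - {to_nat VA}))) of
     (True, VX i s k) \<Rightarrow> linepath (site s (k < 3) 4) (site s (k < 3) 9) +++ linepath (site s (k < 3) 9) (site s (k < 3) 0)
   | _ \<Rightarrow> linepath (position (Min e)) (position (Max e)))"

lemma position_role: "r < 9 \<Longrightarrow> position (to_nat (role i s k r)) = site s (k < 3) r"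
  by (simp add: position_def vertex_site_role)

lemma curve_bent:
  "curve {to_nat (VX i s k), to_nat VA}
    = linepath (site s (k < 3) 4) (site s (k < 3) 9) +++ linepath (site s (k < 3) 9) (site s (k < 3) 0)"
proof -
  have "{to_nat (VX i s k), to_nat VA} - {to_nat VA} = {to_nat (VX i s k)}" by auto
  then show ?thesis by (simp add: curve_def)
qed

lemma curve_straight:
  assumes "(r, r') \<in> set role_edges" "(r, r') \<noteq> (4, 0)"
  shows "curve {to_nat (role i s k r), to_nat (role i s k r')}
     \<in> {linepath (site s (k < 3) r) (site s (k < 3) r'), linepath (site s (k < 3) r') (site s (k < 3) r)}"
proof -
  let ?e = "{to_nat (role i s k r), to_nat (role i s k r')}"
  have r: "r < 9" "r' < 9" "r \<noteq> r'" using role_edges_bounds[OF assms(1)] by auto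
  have "curve ?e = linepath (position (Min ?e)) (position (Max ?e))"
  proof (cases "to_nat VA \<in> ?e")
    case True
    moreover have VA: "VA = role i s k 0" by (simp add: role_def)
    ultimately have "r = 0 \<or> r' = 0"
      using inj_on_eq_iff[OF inj_role, of 0 _ i s k] r by auto
    \<comment> \<open>None of these neighbours of a is a copy of x, so the default case of
      \<open>curve\<close> applies.\<close>
    then have "(r, r') \<in> {(0, 1), (0, 2), (0, 3), (5, 0), (6, 0)}"
      using assms by (auto simp: role_edges_def)
    then have "\<exists>m. ?e = {to_nat VA, to_nat (role i s k m)} \<and> m \<in> {1, 2, 3, 5, 6}"
      unfolding VA by (auto simp: insert_commute)
    then obtain m where m: "?e = {to_nat VA, to_nat (role i s k m)}" "m \<in> {1, 2, 3, 5, 6}" by blast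
    define v where "v = role i s k m"
    have v: "?e = {to_nat VA, to_nat v}" "v \<noteq> VA" "\<And>i s k. v \<noteq> VX i s k"
      using m by (auto simp: v_def role_def)
    then have "?e - {to_nat VA} = {to_nat v}" by auto
    then show ?thesis using v(3) by (simp add: curve_def split: vertex.split bool.split)
  qed (simp add: curve_def)
  then show ?thesis
    using r by (auto simp: min_def max_def position_role)
qed

lemma curve_role_edge:
  fixes i k r r' :: nat and s :: bool
  assumes "(r, r') \<in> set role_edges"
  defines "e \<equiv> {to_nat (role i s k r), to_nat (role i s k r')}"
  shows "arc (curve e)" "curve_between position e (curve e)" "path_image (curve e) = curve_image s (k < 3) (r, r')"
proof -
  let ?f = "k < 3"
  have r: "r < 9" "r' < 9" "r \<noteq> r'" using role_edges_bounds[OF assms(1)] by auto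
  have pos: "position (to_nat (role i s k r)) = site s ?f r" "position (to_nat (role i s k r')) = site s ?f r'"
    using position_role r by auto
  have ne: "site s ?f u \<noteq> site s ?f v" if "u < 10" "v < 10" "u \<noteq> v" for u v
    using inj_site[of s ?f] that by (auto dest: inj_onD)
  have "arc (curve e) \<and> curve_between position e (curve e) \<and> path_image (curve e) = curve_image s ?f (r, r')"
  proof (cases "(r, r') = (4, 0)")
    case True
    then have e: "e = {to_nat (VX i s k), to_nat VA}" by (simp add: e_def role_def)
    have c: "curve e = linepath (site s ?f 4) (site s ?f 9) +++ linepath (site s ?f 9) (site s ?f 0)"
      unfolding e by (rule curve_bent)
    have all: "(4, 9) \<in> set all_pieces" by (simp add: all_pieces_def role_edges_def pieces_def)
    \<comment> \<open>The two halves meet only at the bend, which makes their join an arc.\<close>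
    have "piece s ?f (4, 9) \<inter> piece s ?f (9, 0) \<subseteq> {site s ?f 9}"
      by (rule pieces_adjacent[OF all]) (auto simp: doubleton_eq_iff)
    then have "arc (curve e)"
      unfolding c by (intro arc_join arc_linepath ne) simp_all
    moreover have "curve_between position e (curve e)"
    proof -
      have "pathstart (curve e) = position (to_nat (role i s k r)) \<and>
          pathfinish (curve e) = position (to_nat (role i s k r'))"
        using pos True by (simp add: c)
      then show ?thesis
        using \<open>arc (curve e)\<close> arc_imp_path unfolding curve_between_def e_def by blast
    qed
    moreover have "path_image (curve e) = curve_image s ?f (r, r')"
      using True by (simp add: c path_image_join curve_image_def pieces_def)
    ultimately show ?thesis by blast
  next
    case False
    have "arc (curve e)"
      using curve_straight[OF assms(1) False, of i s k] ne[of r r'] ne[of r' r] r unfolding e_def by auto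
    moreover have "curve_between position e (curve e)"
    proof -
      have "e = {to_nat (role i s k r'), to_nat (role i s k r)}"
        unfolding e_def by (rule insert_commute)
      moreover have "(pathstart (curve e) = position (to_nat (role i s k r)) \<and>
           pathfinish (curve e) = position (to_nat (role i s k r')))
         \<or> (pathstart (curve e) = position (to_nat (role i s k r')) \<and>
           pathfinish (curve e) = position (to_nat (role i s k r)))"
        using curve_straight[OF assms(1) False, of i s k] pos unfolding e_def by auto
      ultimately show ?thesis
        using \<open>arc (curve e)\<close> arc_imp_path e_def unfolding curve_between_def by blast
    qed
    moreover have "path_image (curve e) = curve_image s ?f (r, r')"
      using curve_straight[OF assms(1) False, of i s k] False unfolding e_def
      by (auto simp: curve_image_def pieces_def closed_segment_commute)
    ultimately show ?thesis by blast
  qed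
  then show "arc (curve e)" "curve_between position e (curve e)" "path_image (curve e) = curve_image s ?f (r, r')"
    by blast+
qed

text \<open>Every triple (i, s, k) has its own time step, 5 * 2 * 6 = 60 in all, counted from 1. In
  this order the steps sharing a \<open>VY\<close> are six consecutive ones and those sharing a
  \<open>VD\<close> twelve, so lives are intervals.\<close>

definition time_of :: "nat \<Rightarrow> bool \<Rightarrow> nat \<Rightarrow> nat" where
  "time_of i s k = 12 * i + (if s then 6 else 0) + k + 1"

fun first_time :: "vertex \<Rightarrow> nat" where
  "first_time (VD i) = 12 * i + 1"
| "first_time (VX i s k) = time_of i s k"
| "first_time (VW i s k) = time_of i s k"
| "first_time (VU i s k) = time_of i s k"
| "first_time (VY i s f) = time_of i s 0"
| "first_time _ = 1"

fun last_time :: "vertex \<Rightarrow> nat" where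
  "last_time (VD i) = 12 * i + 12"
| "last_time (VX i s k) = time_of i s k"
| "last_time (VW i s k) = time_of i s k"
| "last_time (VU i s k) = time_of i s k"
| "last_time (VY i s f) = time_of i s 5"
| "last_time _ = 60"

definition vertex_life :: "vertex \<Rightarrow> nat set" where
  [simp]: "vertex_life v = {first_time v..last_time v}"

definition lifetime :: "nat \<Rightarrow> nat set" where
  "lifetime = vertex_life \<circ> from_nat"

lemma lifetime_to_nat [simp]: "lifetime (to_nat v) = vertex_life v"
  by (simp add: lifetime_def)

lemma time_of_cases:
  assumes "t \<in> {1..60}"
  obtains i s k where "i < 5" "k < 6" "t = time_of i s k"
proof -
  let ?m = "(t - 1) mod 12"
  have t: "t = 12 * ((t - 1) div 12) + ?m + 1" "(t - 1) div 12 < 5" "?m < 12"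
    using assms by auto
  show thesis
    by (rule that[of "(t - 1) div 12" "if 6 \<le> ?m then ?m - 6 else ?m" "6 \<le> ?m"])
      (use t in \<open>auto simp: time_of_def\<close>)
qed

lemma time_of_inject:
  assumes "time_of i s k = time_of i' s' k'" "k < 6" "k' < 6"
  shows "i = i'" "s = s'" "k = k'"
proof -
  have "i = i' \<and> s = s' \<and> k = k'"
    using assms unfolding time_of_def by (cases s; cases s'; simp) presburger+
  then show "i = i'" "s = s'" "k = k'" by blast+
qed

lemma role_times:
  assumes "i < 5" "k < 6" "r < 9"
  shows "1 \<le> first_time (role i s k r)" "first_time (role i s k r) \<le> last_time (role i s k r)"
    "last_time (role i s k r) \<le> 60"
  using less_9_cases[OF assms(3)] assms(1,2)
  by (elim disjE; simp add: role_def time_of_def)+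

section \<open>What is visible at each time step\<close>

lemma role_visible:
  assumes "i < 5" "k < 6" "r < 9"
  shows "time_of i s k \<in> vertex_life (role i s k r)"
  using less_9_cases[OF assms(3)] assms(1,2)
  by (elim disjE) (auto simp: role_def time_of_def)

lemma role_simps:
  "role i s k 0 = VA" "role i s k 1 = (if s then VC else VB)" "role i s k 2 = VD i"
  "role i s k 3 = (if s then VB else VC)" "role i s k 4 = VX i s k" "role i s k 5 = VW i s k"
  "role i s k 6 = VU i s k" "role i s k 7 = VY i s (k < 3)" "role i s k 8 = VY i s (\<not> k < 3)"
  by (simp_all add: role_def)

lemma visible_D:
  assumes "time_of i s k \<in> vertex_life (VD i')" "k < 6"
  shows "i' = i"
  using assms unfolding time_of_def by (cases s) auto

lemma visible_gadget:
  assumes "time_of i s k \<in> vertex_life (role i' s' k' r')" "r' \<in> {4, 5, 6}" "k < 6" "k' < 6"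
  shows "i' = i \<and> s' = s \<and> k' = k"
proof -
  have "time_of i s k = time_of i' s' k'" using assms(1,2) by (auto simp: role_simps)
  from time_of_inject[OF this assms(3,4)] show ?thesis by simp
qed

lemma visible_Y:
  assumes "time_of i s k \<in> vertex_life (VY i' s' f)" "k < 6"
  shows "i' = i \<and> s' = s"
  using assms by (cases s; cases s'; simp add: time_of_def) presburger+

text \<open>Vertices named through another gadget are renamed in the current one: \<open>VB\<close>
  and \<open>VC\<close> exchange roles 1 and 3 between the faces, a \<open>VY\<close> exchanges 7
  and 8 between the two groups of copies.\<close>

lemma visible_role:
  assumes "time_of i s k \<in> vertex_life (role i' s' k' r')" "k < 6" "k' < 6" "r' < 9"
  shows "\<exists>r<9. role i' s' k' r' = role i s k r"
proof (cases "r' \<in> {4, 5, 6}")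
  case True
  then show ?thesis using visible_gadget[OF assms(1) _ assms(2,3)] assms(4) by blast
next
  case False
  then consider "r' = 0" | "r' = 1" | "r' = 2" | "r' = 3" | "r' = 7" | "r' = 8"
    using less_9_cases[OF assms(4)] by blast
  then show ?thesis
  proof cases
    assume "r' = 0"
    then have "role i' s' k' r' = role i s k 0" by (simp only: role_simps)
    then show ?thesis by (intro exI[of _ 0]) simp
  next
    assume "r' = 1"
    then have "role i' s' k' r' = role i s k (if s = s' then 1 else 3)" by (auto simp only: role_simps split: if_splits)
    then show ?thesis by (intro exI[of _ "if s = s' then 1 else 3"]) simp
  next
    assume r': "r' = 2"
    then have "i' = i" using visible_D assms(1,2) by (simp only: role_simps)
    then show ?thesis using r' by (intro exI[of _ 2]) (simp add: role_simps)
  next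
    assume "r' = 3"
    then have "role i' s' k' r' = role i s k (if s = s' then 3 else 1)" by (auto simp only: role_simps split: if_splits)
    then show ?thesis by (intro exI[of _ "if s = s' then 3 else 1"]) simp
  next
    assume r': "r' = 7"
    then have "i' = i \<and> s' = s" using visible_Y assms(1,2) by (simp only: role_simps)
    then show ?thesis using r' by (intro exI[of _ "if (k < 3) = (k' < 3) then 7 else 8"]) (auto simp: role_simps)
  next
    assume r': "r' = 8"
    then have "i' = i \<and> s' = s" using visible_Y assms(1,2) by (simp only: role_simps)
    then show ?thesis using r' by (intro exI[of _ "if (k < 3) = (k' < 3) then 8 else 7"]) (auto simp: role_simps)
  qed
qed

text \<open>Edges outside the K4 have an end among roles 4, 5, 6, visible only in its own step.
  Visible edges of the K4 belong to the current gadget too, up to exchanging roles 1 and 3.\<close>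

lemma visible_edge:
  assumes "time_of i s k \<in> vertex_life (role i' s' k' a)" "time_of i s k \<in> vertex_life (role i' s' k' b)"
    and "(a, b) \<in> set role_edges" "k < 6" "k' < 6"
  shows "\<exists>(r, r')\<in>set role_edges. {to_nat (role i' s' k' a), to_nat (role i' s' k' b)}
    = {to_nat (role i s k r), to_nat (role i s k r')}"
proof (cases "a \<in> {4, 5, 6} \<or> b \<in> {4, 5, 6}")
  case True
  then have "i' = i \<and> s' = s \<and> k' = k"
    using visible_gadget[OF assms(1) _ assms(4,5)] visible_gadget[OF assms(2) _ assms(4,5)] by blast
  then show ?thesis using assms(3) by blast
next
  case False
  then have ab: "(a, b) \<in> {(0, 1), (0, 2), (0, 3), (1, 2), (1, 3), (2, 3)}"
    using assms(3) by (auto simp: role_edges_def)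
  have D: "i' = i" if "a = 2 \<or> b = 2"
    using that visible_D[OF _ assms(4)] assms(1,2) by (auto simp only: role_simps)
  \<comment> \<open>\<open>4 - r\<close> exchanges 1 and 3, while 0 and 2 stay. The exchange may
    reverse a listed pair, so both directions are considered.\<close>
  define g where "g r = (if s = s' \<or> even r then r else 4 - r)" for r :: nat
  have "role i' s' k' a = role i s k (g a)" "role i' s' k' b = role i s k (g b)"
    using ab D by (auto simp: role_simps role_simps(2)[unfolded One_nat_def] g_def)
  then have "{to_nat (role i' s' k' a), to_nat (role i' s' k' b)} = {to_nat (role i s k (g a)), to_nat (role i s k (g b))}"
    "{to_nat (role i' s' k' a), to_nat (role i' s' k' b)} = {to_nat (role i s k (g b)), to_nat (role i s k (g a))}"
    by (simp_all only: insert_commute)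
  moreover have "(g a, g b) \<in> set role_edges \<or> (g b, g a) \<in> set role_edges"
  proof -
    have "(0, 1) \<in> set role_edges" "(0, 2) \<in> set role_edges" "(0, 3) \<in> set role_edges"
      "(1, 2) \<in> set role_edges" "(1, 3) \<in> set role_edges" "(2, 3) \<in> set role_edges"
      by (simp_all add: role_edges_def)
    then show ?thesis using ab by (cases "s = s'") (auto simp: g_def)
  qed
  ultimately show ?thesis by blast
qed

lemma frame_vertices_time_of:
  assumes "i < 5" "k < 6"
  shows "frame_vertices graph_vertices lifetime (time_of i s k) = {to_nat (role i s k r) | r. r < 9}"
proof
  show "frame_vertices graph_vertices lifetime (time_of i s k) \<subseteq> {to_nat (role i s k r) | r. r < 9}"
  proof
    fix x assume "x \<in> frame_vertices graph_vertices lifetime (time_of i s k)"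
    then obtain i' s' k' r' where "x = to_nat (role i' s' k' r')" "k' < 6" "r' < 9"
      "time_of i s k \<in> vertex_life (role i' s' k' r')"
      unfolding frame_vertices_def graph_vertices_def by auto
    then show "x \<in> {to_nat (role i s k r) | r. r < 9}"
      using visible_role[of i s k i' s' k' r'] assms by auto
  qed
  show "{to_nat (role i s k r) | r. r < 9} \<subseteq> frame_vertices graph_vertices lifetime (time_of i s k)"
    using role_visible[OF assms] assms unfolding frame_vertices_def graph_vertices_def by auto
qed

lemma frame_edges_time_of:
  assumes "i < 5" "k < 6" "e \<in> frame_edges graph_vertices graph_edges lifetime (time_of i s k)"
  shows "\<exists>(r, r')\<in>set role_edges. e = {to_nat (role i s k r), to_nat (role i s k r')}"
proof -
  from assms(3) obtain i' s' k' a b where e: "e = {to_nat (role i' s' k' a), to_nat (role i' s' k' b)}"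
    "k' < 6" "(a, b) \<in> set role_edges" and "e \<subseteq> frame_vertices graph_vertices lifetime (time_of i s k)"
    unfolding frame_edges_def graph_edges_def by auto
  then have "time_of i s k \<in> vertex_life (role i' s' k' a)" "time_of i s k \<in> vertex_life (role i' s' k' b)"
    unfolding frame_vertices_def by auto
  from visible_edge[OF this e(3) assms(2) e(2)] show ?thesis unfolding e(1) .
qed

text \<open>Every frame is one drawing of the nine roles, so all conditions reduce to those proved
  for \<open>site\<close> and \<open>curve_image\<close>.\<close>

lemma planar_frame:
  assumes i: "i < 5" and k: "k < 6"
  shows "planar_drawing (frame_vertices graph_vertices lifetime (time_of i s k))
    (frame_edges graph_vertices graph_edges lifetime (time_of i s k)) position curve"
    (is "planar_drawing ?W ?F position curve")
proof -
  let ?v = "\<lambda>r. to_nat (role i s k r)"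
  have W: "?W = {?v r | r. r < 9}" by (rule frame_vertices_time_of[OF i k])
  have F: "\<exists>(r, r')\<in>set role_edges. e = {?v r, ?v r'}" if "e \<in> ?F" for e
    using frame_edges_time_of[OF i k that] .
  have inj: "inj_on position ?W"
  proof
    fix x y assume xy: "x \<in> ?W" "y \<in> ?W" "position x = position y"
    then obtain r r' where r: "r < 9" "r' < 9" "x = ?v r" "y = ?v r'" unfolding W by blast
    then have "site s (k < 3) r = site s (k < 3) r'" using xy(3) by (simp add: position_role)
    then have "r = r'" using inj_onD[OF inj_site[of s "k < 3"], of r r'] r(1,2) by simp
    then show "x = y" using r by simp
  qed
  have off: "w \<in> e" if off: "e \<in> ?F" "w \<in> ?W" "position w \<in> path_image (curve e)" for e w
  proof -
    obtain r r' where e: "(r, r') \<in> set role_edges" "e = {?v r, ?v r'}" using F[OF off(1)] by blast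
    obtain m where m: "m < 9" "w = ?v m" using off(2) unfolding W by blast
    have "site s (k < 3) m \<in> curve_image s (k < 3) (r, r')"
      using off(3) m e curve_role_edge(3)[OF e(1), of i s k] by (simp add: position_role)
    from site_off_curve[OF e(1) m(1) this] show ?thesis using m e by auto
  qed
  have good: "arc (curve e)" "curve_between position e (curve e)" if "e \<in> ?F" for e
    using F[OF that] curve_role_edge by auto
  have meet: "path_image (curve e) \<inter> path_image (curve f) \<subseteq> position ` (e \<inter> f) \<and> card (e \<inter> f) \<le> 1"
    if ef: "e \<in> ?F" "f \<in> ?F" "e \<noteq> f" for e f
  proof -
    obtain a b where e: "(a, b) \<in> set role_edges" "e = {?v a, ?v b}" using F[OF ef(1)] by blast
    obtain c d where f: "(c, d) \<in> set role_edges" "f = {?v c, ?v d}" using F[OF ef(2)] by blast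
    have "(a, b) \<noteq> (c, d)" using ef(3) e f by auto
    from curve_images_meet[OF e(1) f(1) this, of s "k < 3"]
    have "path_image (curve e) \<inter> path_image (curve f) \<subseteq> site s (k < 3) ` ({a, b} \<inter> {c, d})"
      using curve_role_edge(3)[OF e(1), of i s k] curve_role_edge(3)[OF f(1), of i s k] e f by simp
    also have "\<dots> \<subseteq> position ` (e \<inter> f)"
    proof
      fix z assume "z \<in> site s (k < 3) ` ({a, b} \<inter> {c, d})"
      then obtain m where m: "z = site s (k < 3) m" "m \<in> {a, b}" "m \<in> {c, d}" by blast
      then have "m < 9" using role_edges_bounds[OF e(1)] by auto
      then have "z = position (?v m)" using m by (simp add: position_role)
      moreover have "?v m \<in> e \<inter> f" using m e f by auto
      ultimately show "z \<in> position ` (e \<inter> f)" by blast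
    qed
    finally have "path_image (curve e) \<inter> path_image (curve f) \<subseteq> position ` (e \<inter> f)" .
    \<comment> \<open>Distinct two-element sets share at most one element; this bounds the common
      points of two curves by one, as a simple drawing demands.\<close>
    moreover have "card (e \<inter> f) \<le> 1"
    proof -
      have "e \<inter> f \<noteq> e" if "card e = 2" "card f = 2"
        using that \<open>e \<noteq> f\<close> card_subset_eq[of f e] by (metis card.infinite inf.absorb_iff1 zero_neq_numeral)
      moreover have "card e = 2" "card f = 2"
        using role_edges_bounds[OF e(1)] role_edges_bounds[OF f(1)] inj_on_eq_iff[OF inj_role[of i s k]]
        unfolding e f by auto
      ultimately have "card (e \<inter> f) < 2"
        using psubset_card_mono[of e "e \<inter> f"] e(2) by auto
      then show ?thesis by simp
    qed
    ultimately show ?thesis by blast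
  qed
  have few: "finite (path_image (curve e) \<inter> path_image (curve f)) \<and>
      card (path_image (curve e) \<inter> path_image (curve f)) \<le> 1"
    if "e \<in> ?F" "f \<in> ?F" "e \<noteq> f" for e f
  proof -
    have "finite (e \<inter> f)" using F[OF that(1)] by auto
    then have fin: "finite (position ` (e \<inter> f))" "card (position ` (e \<inter> f)) \<le> 1"
      using conjunct2[OF meet[OF that]] card_image_le[of "e \<inter> f" position] by simp_all
    note sub = conjunct1[OF meet[OF that]]
    show ?thesis
      using finite_subset[OF sub fin(1)] card_mono[OF fin(1) sub] fin(2) by simp
  qed
  have drawing: "is_drawing ?W ?F position curve"
    unfolding is_drawing_def by (intro conjI ballI impI; (rule inj | erule good | (erule off; assumption)))
  show ?thesis
    unfolding planar_drawing_def simple_drawing_def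
    by (intro conjI ballI impI; (rule drawing | (rule few[THEN conjunct1] few[THEN conjunct2] meet[THEN conjunct1]; assumption)))
qed

lemma graph_planar_storyplan:
  "planar_storyplan graph_vertices graph_edges 60 lifetime position curve"
proof -
  have interval: "\<exists>a b. 1 \<le> a \<and> a \<le> b \<and> b \<le> 60 \<and> lifetime v = {a..b}" if v_in: "v \<in> graph_vertices" for v
  proof -
    obtain i s k r where r: "i < 5" "k < 6" "r < 9" and v: "v = to_nat (role i s k r)"
      using v_in unfolding graph_vertices_def by blast
    have "lifetime v = {first_time (role i s k r)..last_time (role i s k r)}" by (simp add: v)
    then show ?thesis using role_times[OF r, of s] by blast
  qed
  have edge: "lifetime u \<inter> lifetime v \<noteq> {}" "curve_between position e (curve e)"
    if e_in: "e \<in> graph_edges" and uv: "e = {u, v}" for e u v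
  proof -
    obtain i s k r r' where e: "e = {to_nat (role i s k r), to_nat (role i s k r')}" "i < 5" "k < 6"
      "(r, r') \<in> set role_edges"
      using e_in unfolding graph_edges_def by blast
    have "time_of i s k \<in> lifetime x" if x: "x \<in> e" for x
    proof -
      obtain m where "m < 9" "x = to_nat (role i s k m)"
        using x role_edges_bounds[OF e(4)] unfolding e(1) by blast
      then show ?thesis using role_visible[OF e(2,3), of m s] by simp
    qed
    moreover have "u \<in> e" "v \<in> e" using uv by simp_all
    ultimately show "lifetime u \<inter> lifetime v \<noteq> {}" by blast
    show "curve_between position e (curve e)"
      unfolding e(1) by (rule curve_role_edge(2)[OF e(4)])
  qed
  have pair: "\<exists>u v. e = {u, v}" if "e \<in> graph_edges" for e
    using that unfolding graph_edges_def by blast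
  have "storyplan graph_vertices graph_edges 60 lifetime position curve"
    unfolding storyplan_def
  proof (intro conjI ballI allI impI)
    show "curve_between position e (curve e)" if "e \<in> graph_edges" for e
      using pair[OF that] edge(2)[OF that] by blast
  qed (use interval in \<open>simp_all add: edge(1)\<close>)
  moreover have "planar_drawing (frame_vertices graph_vertices lifetime t)
      (frame_edges graph_vertices graph_edges lifetime t) position curve" if t: "t \<in> {1..60}" for t
    by (rule time_of_cases[OF t]) (simp only: planar_frame)
  ultimately show ?thesis unfolding planar_storyplan_def by (intro conjI ballI)
qed

theorem theorem1:
  shows "\<exists>V E. simple_graph V E \<and> admits_planar_storyplan V E \<and>
            \<not> admits_planar_geometric_storyplan V E"
proof (intro exI conjI)
  show "simple_graph graph_vertices graph_edges" by (rule simple_graph_graph)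
  show "admits_planar_storyplan graph_vertices graph_edges"
    unfolding admits_planar_storyplan_def using graph_planar_storyplan by blast
  show "\<not> admits_planar_geometric_storyplan graph_vertices graph_edges"
    unfolding admits_planar_geometric_storyplan_def
    using geometric_plan.contradiction[OF geometric_plan.intro] by blast
qed

end
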